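(* Let $s>2$, $\beta>0$, and let $(p(n))_{n\ge1}$ satisfy $p(1)=1$, $p(n)\in[0,1)$ for $n\ge2$, and $\lim_{n\to\infty}p(n)/(\beta n^{-s})=1$. Consider the long-range percolation random graph on $\mathbb Z$ with connection probabilities $p(|x-y|)$, with the metric $d(x,y)=|x-y|$ and marked vertex $0$. Then, with $v(x)=r(x)=x$: (1) there exist $\lambda_0>1$ and a function $p^*(\lambda)$ with $p^*(\lambda)\to0$ as $\lambda\to\infty$ such that $\mathbb P(R\in J(\lambda))\ge1-p^*(\lambda)$ for each $R\ge1$, $\lambda\ge\lambda_0$; (2) there is $c_1>0$ such that $\mathbb E[R_{\rm eff}(0,B(R)^c)V(R)]\le c_1R^2$ for all $R\ge1$; (3) there exist $q_0,c_2>0$ such that the function in (1) satisfies $p^*(\lambda)\le c_2\lambda^{-q_0}$.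
   Context: Long-range percolation on $\mathbb Z$: the vertex set is $G=\mathbb Z$, and each unoriented pair of distinct points $x,y\in\mathbb Z$ is connected by an unoriented edge with probability $p(|x-y|)$, independently of other pairs. $\mathbb P$ is the law of this random graph and $\mathbb E$ its expectation. $\mu_x$ is the number of edges having $x$ as an endpoint, extended to a measure $\mu$ on $\mathbb Z$. $B(R)=\{y\in\mathbb Z:|y|<R\}$, $V(R)=\mu(B(R))$. Effective resistance: $\mathcal E(f,f)=\frac12\sum_{x\sim y}(f(x)-f(y))^2$ (sum over ordered pairs of vertices joined by an edge), $H^2=\{f\in\mathbb R^{\mathbb Z}:\mathcal E(f,f)<\infty\}$; for disjoint $A,B$, $R_{\rm eff}(A,B)^{-1}=\inf\{\mathcal E(f,f):f\in H^2,f|_A=1,f|_B=0\}$; $R_{\rm eff}(x,y)=R_{\rm eff}(\{x\},\{y\})$, $R_{\rm eff}(x,x)=0$. For $\lambda>1$, with $v(x)=r(x)=x$, $J(\lambda)$ is the random set of $R\in[1,\infty]$ such that $\lambda^{-1}R\le V(R)\le\lambda R$, $R_{\rm eff}(0,B(R)^c)\ge\lambda^{-1}R$, and $R_{\rm eff}(0,y)\le\lambda|y|$ for all $y\in B(R)$. *)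

theory Defs
  imports "HOL-Probability.Probability"
begin

type_synonym configuration = "int set \<Rightarrow> bool"

definition pairs :: "int set set" where
  "pairs = {e. \<exists>x y. x \<noteq> y \<and> e = {x, y}}"

text \<open>For a pair \<open>e = {x, y}\<close> the distance \<open>\<bar>x - y\<bar>\<close> is \<open>Max e - Min e\<close>.\<close>

definition long_range_percolation :: "(nat \<Rightarrow> real) \<Rightarrow> configuration measure" where
  "long_range_percolation p =
     PiM pairs (\<lambda>e. measure_pmf (bernoulli_pmf (p (nat (Max e - Min e)))))"

definition adj :: "configuration \<Rightarrow> int \<Rightarrow> int \<Rightarrow> bool" where
  "adj \<omega> x y \<longleftrightarrow> x \<noteq> y \<and> \<omega> {x, y}"

text \<open>Degrees, volumes, energies and resistances are extended nonnegative reals: they can be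
  infinite (degrees only on a null set of configurations). In this type the inverse of 0 is
  \<open>\<infinity>\<close>, the inverse of \<open>\<infinity>\<close> is 0 and the infimum of the empty set is \<open>\<infinity>\<close>.\<close>

definition num_edges :: "configuration \<Rightarrow> int \<Rightarrow> ennreal" where
  "num_edges \<omega> x = emeasure (count_space UNIV) {e \<in> pairs. x \<in> e \<and> \<omega> e}"

definition vertex_measure :: "configuration \<Rightarrow> int measure" where
  "vertex_measure \<omega> = density (count_space UNIV) (num_edges \<omega>)"

definition open_ball :: "ennreal \<Rightarrow> int set" where
  "open_ball R = {y. ennreal (real_of_int \<bar>y\<bar>) < R}"

definition ball_vol :: "configuration \<Rightarrow> ennreal \<Rightarrow> ennreal" where
  "ball_vol \<omega> R = emeasure (vertex_measure \<omega>) (open_ball R)"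

definition energy :: "configuration \<Rightarrow> (int \<Rightarrow> real) \<Rightarrow> ennreal" where
  "energy \<omega> f =
     (\<integral>\<^sup>+(x, y). ennreal ((f x - f y)\<^sup>2) \<partial>count_space {(x, y). adj \<omega> x y}) / 2"

definition H2 :: "configuration \<Rightarrow> (int \<Rightarrow> real) set" where
  "H2 \<omega> = {f. energy \<omega> f < \<infinity>}"

definition R_eff_sets :: "configuration \<Rightarrow> int set \<Rightarrow> int set \<Rightarrow> ennreal" where
  "R_eff_sets \<omega> A B =
     inverse (INF f \<in> {f \<in> H2 \<omega>. (\<forall>x\<in>A. f x = 1) \<and> (\<forall>x\<in>B. f x = 0)}. energy \<omega> f)"

definition R_eff :: "configuration \<Rightarrow> int \<Rightarrow> int \<Rightarrow> ennreal" where
  "R_eff \<omega> x y = (if x = y then 0 else R_eff_sets \<omega> {x} {y})"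

text \<open>The volume and resistance growth functions are both the identity, \<open>v(x) = r(x) = x\<close>.\<close>

definition J :: "configuration \<Rightarrow> real \<Rightarrow> ennreal set" where
  "J \<omega> lam = {R. 1 \<le> R \<and>
      ennreal (inverse lam) * R \<le> ball_vol \<omega> R \<and> ball_vol \<omega> R \<le> ennreal lam * R \<and>
      R_eff_sets \<omega> {0} (- open_ball R) \<ge> ennreal (inverse lam) * R \<and>
      (\<forall>y\<in>open_ball R. R_eff \<omega> 0 y \<le> ennreal (lam * real_of_int \<bar>y\<bar>))}"

end

theory Submission
  imports Defs
begin

text \<open>Why the theorem holds. Since \<open>p(1) = 1\<close>, almost surely all nearest-neighbour edges are present.
  This gives for free the lower volume bound, because every degree is at least 1, and the upper
  resistance bound \<open>R_eff(0, y) \<le> \<bar>y\<bar>\<close>, because the path of nearest-neighbour edges is a series of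
  unit resistors. The upper volume bound is Markov's inequality: degrees have a common finite
  mean. The expectation bound of the second part follows from \<open>R_eff(0, B(R)\<^sup>c) \<le> \<lceil>R\<rceil> \<le> 2 R\<close>
  and the same mean.

  What remains is a lower bound for \<open>R_eff(0, B(R)\<^sup>c)\<close>, and it comes from cut edges: edges
  \<open>(i, i+1)\<close> that no other edge crosses. By the series law the resistance is at least half the
  smaller of the numbers of cut edges in \<open>[0, R)\<close> and in \<open>[-R, 0)\<close>
  (\<open>R_eff_sets_ge_cut_edges\<close>). The expected number of edges that cross a given point is
  \<open>\<Sum>n. n p(n)\<close>, finite exactly because \<open>s > 2\<close>, so each edge is a cut edge with probability
  bounded below by some \<open>\<theta> > 0\<close> (\<open>no_crossing_prob_bounded_below\<close>).

  To see that the number of cut edges is rarely much below its mean, edges are split at a length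
  \<open>L\<close>. The events ``no edge of length between 2 and \<open>L\<close> crosses \<open>i\<close>'' are independent at
  distance \<open>L\<close>, because they look at disjoint sets of edges, so their number obeys Chebyshev's
  inequality with error \<open>O(L/N)\<close> in a window of length \<open>N\<close>; the expected proportion of points
  crossed by a longer edge is \<open>O(L\<^sup>-\<^sup>\<delta>)\<close> with \<open>\<delta> = (s - 2)/2\<close> (\<open>prob_few_cut_edges\<close>). With
  \<open>L \<approx> \<surd>N\<close> both errors are a negative power of \<open>N\<close>. This power of the radius becomes a power of
  \<open>\<lambda>\<close> once \<open>R > \<surd>\<lambda>\<close>. For \<open>R \<le> \<surd>\<lambda>\<close> it is enough that the conductance to \<open>B(R)\<^sup>c\<close> is at most
  the degree of 0, whose mean is finite (\<open>prob_R_eff_small\<close>).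

  All these events have to be measurable, although the resistance is an infimum over an
  uncountable family of functions on an infinite graph. A compactness argument
  (\<open>INF_energy_eq_SUP_box\<close>) writes it as a limit of quantities that depend on finitely many
  edges.\<close>

section \<open>Variational bounds for the effective resistance\<close>

lemma ennreal_inverse_antimono: "a \<le> b \<Longrightarrow> inverse b \<le> inverse (a :: ennreal)"
  unfolding less_eq_ennreal.rep_eq inverse_ennreal.rep_eq by (intro ereal_inverse_antimono) auto

text \<open>Functions of infinite energy do not change the infimum, which is \<open>\<infinity>\<close> over the empty set.\<close>

lemma R_eff_sets_alt:
  "R_eff_sets \<omega> A B =
     inverse (INF f \<in> {f. (\<forall>x\<in>A. f x = 1) \<and> (\<forall>x\<in>B. f x = 0)}. energy \<omega> f)"
proof -
  let ?F = "{f :: int \<Rightarrow> real. (\<forall>x\<in>A. f x = 1) \<and> (\<forall>x\<in>B. f x = 0)}"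
  let ?G = "{f \<in> H2 \<omega>. (\<forall>x\<in>A. f x = 1) \<and> (\<forall>x\<in>B. f x = 0)}"
  have "(INF f\<in>?G. energy \<omega> f) \<le> energy \<omega> f" if "f \<in> ?F" for f
  proof (cases "energy \<omega> f < \<infinity>")
    case True
    then show ?thesis using that by (intro INF_lower) (auto simp: H2_def)
  next
    case False
    then show ?thesis by (simp add: not_less top_unique)
  qed
  then have "(INF f\<in>?G. energy \<omega> f) = (INF f\<in>?F. energy \<omega> f)"
    by (intro antisym INF_greatest INF_superset_mono) auto
  then show ?thesis by (simp add: R_eff_sets_def)
qed

lemma R_eff_sets_geI:
  assumes "\<And>x. x \<in> A \<Longrightarrow> f x = 1" "\<And>x. x \<in> B \<Longrightarrow> f x = 0" "energy \<omega> f \<le> c"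
  shows "inverse c \<le> R_eff_sets \<omega> A B"
proof -
  have "(INF f \<in> {f. (\<forall>x\<in>A. f x = 1) \<and> (\<forall>x\<in>B. f x = 0)}. energy \<omega> f) \<le> c"
    using assms by (intro INF_lower2[of f]) auto
  then show ?thesis unfolding R_eff_sets_alt by (rule ennreal_inverse_antimono)
qed

lemma R_eff_sets_leI:
  assumes "\<And>f. (\<And>x. x \<in> A \<Longrightarrow> f x = 1) \<Longrightarrow> (\<And>x. x \<in> B \<Longrightarrow> f x = 0) \<Longrightarrow> c \<le> energy \<omega> f"
  shows "R_eff_sets \<omega> A B \<le> inverse c"
  unfolding R_eff_sets_alt using assms
  by (intro ennreal_inverse_antimono INF_greatest) auto

lemma sum_le_energy:
  assumes "finite S" "S \<subseteq> {(x, y). adj \<omega> x y}"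
  shows "ennreal ((\<Sum>(x, y)\<in>S. (f x - f y)\<^sup>2) / 2) \<le> energy \<omega> f"
proof -
  have "ennreal (\<Sum>(x, y)\<in>S. (f x - f y)\<^sup>2) = (\<Sum>(x, y)\<in>S. ennreal ((f x - f y)\<^sup>2))"
    by (subst sum_ennreal[symmetric]) (auto simp: case_prod_beta)
  also have "\<dots> = (\<integral>\<^sup>+(x, y). ennreal ((f x - f y)\<^sup>2) \<partial>count_space S)"
    using assms by (simp add: nn_integral_count_space_finite)
  also have "\<dots> \<le> (\<integral>\<^sup>+(x, y). ennreal ((f x - f y)\<^sup>2) \<partial>count_space {(x, y). adj \<omega> x y})"
    using assms by (subst (1 2) nn_integral_count_space_indicator)
      (auto intro!: nn_integral_mono split: split_indicator)
  finally have "ennreal (\<Sum>(x, y)\<in>S. (f x - f y)\<^sup>2) / 2 \<le> energy \<omega> f"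
    unfolding energy_def by (rule divide_right_mono_ennreal)
  then show ?thesis
    by (subst ennreal_divide_numeral[symmetric]) (auto intro!: sum_nonneg)
qed

lemma energy_finite_support:
  assumes "finite S" "S \<subseteq> {(x, y). adj \<omega> x y}"
    and "\<And>x y. adj \<omega> x y \<Longrightarrow> (x, y) \<notin> S \<Longrightarrow> f x = f y"
  shows "energy \<omega> f = ennreal ((\<Sum>(x, y)\<in>S. (f x - f y)\<^sup>2) / 2)"
proof -
  have "(\<integral>\<^sup>+(x, y). ennreal ((f x - f y)\<^sup>2) \<partial>count_space {(x, y). adj \<omega> x y})
      = (\<Sum>(x, y)\<in>S. ennreal ((f x - f y)\<^sup>2))"
    using assms by (intro nn_integral_count_space') auto
  also have "\<dots> = ennreal (\<Sum>(x, y)\<in>S. (f x - f y)\<^sup>2)"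
    by (subst sum_ennreal[symmetric]) (auto simp: case_prod_beta)
  finally show ?thesis
    unfolding energy_def by (subst ennreal_divide_numeral[symmetric]) (auto intro!: sum_nonneg)
qed

text \<open>Rayleigh monotonicity in its simplest instance: the nearest-neighbour path from \<open>x\<close> to
  \<open>y\<close> is a series of \<open>\<bar>x - y\<bar>\<close> unit resistors, and adding edges can only lower the resistance.
  The series law is the Cauchy--Schwarz inequality along the path.\<close>

lemma R_eff_sets_le_dist:
  assumes nn: "\<And>i. \<omega> {i, i + 1}" and "x \<in> A" "y \<in> B" "x \<noteq> y"
  shows "R_eff_sets \<omega> A B \<le> ennreal \<bar>x - y\<bar>"
proof -
  define a where "a = min x y"
  define n where "n = nat \<bar>x - y\<bar>"
  have n: "n > 0" using assms by (auto simp: n_def)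
  have "ennreal (1 / real n) \<le> energy \<omega> f"
    if f: "\<And>x. x \<in> A \<Longrightarrow> f x = 1" "\<And>x. x \<in> B \<Longrightarrow> f x = 0" for f :: "int \<Rightarrow> real"
  proof -
    define up where "up k = (a + int k, a + int k + 1)" for k
    define down where "down k = (a + int k + 1, a + int k)" for k
    let ?S = "up ` {..<n} \<union> down ` {..<n}"
    let ?d = "\<lambda>k. f (a + int k + 1) - f (a + int k)"
    have tele: "(\<Sum>k<m. ?d k) = f (a + int m) - f a" for m
      by (induction m) (auto simp: algebra_simps)
    have "f (a + int n) - f a \<in> {f x - f y, f y - f x}"
      unfolding a_def n_def by (auto simp: min_def abs_if)
    then have "(\<Sum>k<n. ?d k)\<^sup>2 = 1"
      unfolding tele using f assms by auto
    then have "1 \<le> (\<Sum>k<n. (?d k)\<^sup>2) * real n"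
      using sum_squared_le_sum_of_squares[of ?d "{..<n}"] by simp
    then have 1: "1 / real n \<le> (\<Sum>k<n. (?d k)\<^sup>2)"
      using n by (simp add: field_simps)
    have "(\<Sum>(x, y)\<in>?S. (f x - f y)\<^sup>2)
        = (\<Sum>(x, y)\<in>up ` {..<n}. (f x - f y)\<^sup>2) + (\<Sum>(x, y)\<in>down ` {..<n}. (f x - f y)\<^sup>2)"
      by (rule sum.union_disjoint) (auto simp: up_def down_def)
    also have "(\<Sum>(x, y)\<in>up ` {..<n}. (f x - f y)\<^sup>2)
        = (\<Sum>k<n. (f (a + int k) - f (a + int k + 1))\<^sup>2)"
      by (subst sum.reindex) (auto simp: inj_on_def up_def)
    also have "\<dots> = (\<Sum>k<n. (?d k)\<^sup>2)"
      by (intro sum.cong refl) (rule power2_commute)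
    also have "(\<Sum>(x, y)\<in>down ` {..<n}. (f x - f y)\<^sup>2) = (\<Sum>k<n. (?d k)\<^sup>2)"
      by (subst sum.reindex) (auto simp: inj_on_def down_def)
    finally have 2: "(\<Sum>(x, y)\<in>?S. (f x - f y)\<^sup>2) / 2 = (\<Sum>k<n. (?d k)\<^sup>2)" by simp
    have "?S \<subseteq> {(x, y). adj \<omega> x y}"
      using nn by (auto simp: adj_def up_def down_def insert_commute)
    then have "ennreal ((\<Sum>(x, y)\<in>?S. (f x - f y)\<^sup>2) / 2) \<le> energy \<omega> f"
      by (intro sum_le_energy) auto
    with 1 show ?thesis unfolding 2 by (meson ennreal_leI order_trans)
  qed
  then have "R_eff_sets \<omega> A B \<le> inverse (ennreal (1 / real n))"
    by (rule R_eff_sets_leI)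
  also have "\<dots> = ennreal \<bar>x - y\<bar>"
    using n by (simp add: inverse_ennreal n_def)
  finally show ?thesis .
qed

definition cut_edge :: "configuration \<Rightarrow> int \<Rightarrow> bool" where
  "cut_edge \<omega> i \<longleftrightarrow>
     \<omega> {i, i + 1} \<and> (\<forall>x y. x \<le> i \<longrightarrow> i < y \<longrightarrow> (x, y) \<noteq> (i, i + 1) \<longrightarrow> \<not> \<omega> {x, y})"

text \<open>A function that changes only across cut edges sees no other edge: every edge that crosses a
  cut edge is that cut edge itself.\<close>

lemma energy_cut_edges:
  fixes f g :: "int \<Rightarrow> real"
  assumes "finite C" and cut: "\<And>i. i \<in> C \<Longrightarrow> cut_edge \<omega> i"
    and f: "\<And>x y. x < y \<Longrightarrow> f y - f x = (\<Sum>i\<in>C \<inter> {x..<y}. g i)"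
  shows "energy \<omega> f = ennreal (\<Sum>i\<in>C. (g i)\<^sup>2)"
proof -
  define up where "up i = (i, i + 1)" for i :: int
  define down where "down i = (i + 1, i)" for i :: int
  let ?S = "up ` C \<union> down ` C"
  have step: "f (i + 1) - f i = g i" if "i \<in> C" for i
  proof -
    have "C \<inter> {i..<i+1} = {i}" using that by auto
    then show ?thesis using f[of i "i + 1"] by simp
  qed
  have const: "f x = f y" if "x < y" "\<omega> {x, y}" "(x, y) \<notin> up ` C" for x y
  proof -
    have "C \<inter> {x..<y} = {}"
      using that cut unfolding cut_edge_def up_def by fastforce
    then show ?thesis using f[OF \<open>x < y\<close>] by simp
  qed
  have "energy \<omega> f = ennreal ((\<Sum>(x, y)\<in>?S. (f x - f y)\<^sup>2) / 2)"
  proof (rule energy_finite_support)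
    show "?S \<subseteq> {(x, y). adj \<omega> x y}"
      using cut by (auto simp: adj_def up_def down_def cut_edge_def insert_commute)
    fix x y assume xy: "adj \<omega> x y" "(x, y) \<notin> ?S"
    then have "(y, x) \<notin> up ` C" by (auto simp: up_def down_def)
    moreover have "\<omega> {x, y}" "\<omega> {y, x}" "x \<noteq> y"
      using xy by (auto simp: adj_def insert_commute)
    ultimately show "f x = f y"
      using xy(2) const[of x y] const[of y x] by (metis UnI1 linorder_neqE)
  qed (use assms in auto)
  also have "(\<Sum>(x, y)\<in>?S. (f x - f y)\<^sup>2)
      = (\<Sum>(x, y)\<in>up ` C. (f x - f y)\<^sup>2) + (\<Sum>(x, y)\<in>down ` C. (f x - f y)\<^sup>2)"
    using \<open>finite C\<close> by (intro sum.union_disjoint) (auto simp: up_def down_def)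
  also have "(\<Sum>(x, y)\<in>up ` C. (f x - f y)\<^sup>2) = (\<Sum>i\<in>C. (f i - f (i + 1))\<^sup>2)"
    by (subst sum.reindex) (auto simp: inj_on_def up_def)
  also have "\<dots> = (\<Sum>i\<in>C. (g i)\<^sup>2)"
    by (intro sum.cong refl) (metis step power2_commute)
  also have "(\<Sum>(x, y)\<in>down ` C. (f x - f y)\<^sup>2) = (\<Sum>i\<in>C. (f (i + 1) - f i)\<^sup>2)"
    by (subst sum.reindex) (auto simp: inj_on_def down_def)
  also have "\<dots> = (\<Sum>i\<in>C. (g i)\<^sup>2)"
    by (intro sum.cong refl) (simp add: step)
  finally show ?thesis by simp
qed

text \<open>With \<open>X\<close> cut edges to the right of 0 and \<open>Y\<close> to the left, current leaves 0 through two
  parallel branches, of resistance at least \<open>X\<close> and at least \<open>Y\<close> by the series law. The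
  corresponding potential drops by \<open>1/X\<close> at each cut edge on the right and by \<open>1/Y\<close> at each one on
  the left, so its energy is \<open>1/X + 1/Y\<close>.\<close>

lemma R_eff_sets_ge_cut_edges:
  fixes N :: nat and m :: real
  assumes "m > 0" "m \<le> card {i \<in> {0..<int N}. cut_edge \<omega> i}"
    and "m \<le> card {i \<in> {- int N..<0}. cut_edge \<omega> i}"
    and B: "B \<subseteq> {y. \<bar>y\<bar> \<ge> int N}"
  shows "ennreal (m / 2) \<le> R_eff_sets \<omega> {0} B"
proof -
  define C D where "C = {i \<in> {0..<int N}. cut_edge \<omega> i}" and "D = {i \<in> {- int N..<0}. cut_edge \<omega> i}"
  define X Y where "X = real (card C)" and "Y = real (card D)"
  have fin: "finite C" "finite D"
    unfolding C_def D_def by (auto intro: finite_subset[of _ "{- int N..<int N}"])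
  have XY: "X \<ge> m" "Y \<ge> m"
    using assms by (auto simp: C_def D_def X_def Y_def)
  define f where "f x = 1 - card {i \<in> C. i < x} / X - card {i \<in> D. x \<le> i} / Y" for x
  define g where "g i = (if i \<ge> 0 then - 1 / X else 1 / Y)" for i :: int
  have pos: "X > 0" "Y > 0" using XY \<open>m > 0\<close> by auto
  have CD: "C \<inter> D = {}" by (auto simp: C_def D_def)
  have diff: "f y - f x = (\<Sum>i\<in>(C \<union> D) \<inter> {x..<y}. g i)" if "x < y" for x y
  proof -
    have "{i \<in> C. i < y} = {i \<in> C. i < x} \<union> C \<inter> {x..<y}" using that by auto
    then have 1: "card {i \<in> C. i < y} = card {i \<in> C. i < x} + card (C \<inter> {x..<y})"
      using fin by (simp add: card_Un_disjoint disjoint_iff)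
    have "{i \<in> D. x \<le> i} = {i \<in> D. y \<le> i} \<union> D \<inter> {x..<y}" using that by auto
    then have 2: "card {i \<in> D. x \<le> i} = card {i \<in> D. y \<le> i} + card (D \<inter> {x..<y})"
      using fin by (simp add: card_Un_disjoint disjoint_iff)
    have "(\<Sum>i\<in>(C \<union> D) \<inter> {x..<y}. g i) = (\<Sum>i\<in>C \<inter> {x..<y}. g i) + (\<Sum>i\<in>D \<inter> {x..<y}. g i)"
      using fin CD by (subst Int_Un_distrib2, intro sum.union_disjoint) auto
    also have "(\<Sum>i\<in>C \<inter> {x..<y}. g i) = (\<Sum>i\<in>C \<inter> {x..<y}. - 1 / X)"
      by (intro sum.cong) (auto simp: g_def C_def)
    also have "(\<Sum>i\<in>D \<inter> {x..<y}. g i) = (\<Sum>i\<in>D \<inter> {x..<y}. 1 / Y)"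
      by (intro sum.cong) (auto simp: g_def D_def)
    finally show ?thesis
      unfolding f_def 1 2 by (simp add: add_divide_distrib)
  qed
  have "energy \<omega> f = ennreal (\<Sum>i\<in>C \<union> D. (g i)\<^sup>2)"
    using fin by (intro energy_cut_edges diff) (auto simp: C_def D_def)
  also have "(\<Sum>i\<in>C \<union> D. (g i)\<^sup>2) = (\<Sum>i\<in>C. (g i)\<^sup>2) + (\<Sum>i\<in>D. (g i)\<^sup>2)"
    using fin CD by (intro sum.union_disjoint)
  also have "(\<Sum>i\<in>C. (g i)\<^sup>2) = (\<Sum>i\<in>C. (1 / X)\<^sup>2)"
    by (intro sum.cong) (auto simp: g_def C_def power_divide)
  also have "\<dots> = 1 / X"
    using pos by (simp add: X_def power2_eq_square field_simps)
  also have "(\<Sum>i\<in>D. (g i)\<^sup>2) = (\<Sum>i\<in>D. (1 / Y)\<^sup>2)"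
    by (intro sum.cong) (auto simp: g_def D_def)
  also have "\<dots> = 1 / Y"
    using pos by (simp add: Y_def power2_eq_square field_simps)
  also have "ennreal (1 / X + 1 / Y) \<le> ennreal (1 / m + 1 / m)"
    using XY \<open>m > 0\<close> by (intro ennreal_leI add_mono divide_left_mono) auto
  finally have en: "energy \<omega> f \<le> ennreal (2 / m)" by simp
  have "inverse (ennreal (2 / m)) \<le> R_eff_sets \<omega> {0} B"
  proof (rule R_eff_sets_geI[OF _ _ en])
    fix x :: int assume "x \<in> {0}"
    moreover have "{i \<in> C. i < 0} = {}" and "{i \<in> D. 0 \<le> i} = {}"
      by (auto simp: C_def D_def)
    then have "f 0 = 1" unfolding f_def by (simp only:) simp
    ultimately show "f x = 1" by simp
  next
    fix x assume "x \<in> B"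
    then have "x \<ge> int N \<or> x \<le> - int N" using B by auto
    then show "f x = 0"
    proof
      assume "x \<ge> int N"
      then have eqs: "{i \<in> C. i < x} = C" "{i \<in> D. x \<le> i} = {}" by (auto simp: C_def D_def)
      show ?thesis unfolding f_def eqs using pos by (simp add: X_def)
    next
      assume "x \<le> - int N"
      then have eqs: "{i \<in> C. i < x} = {}" "{i \<in> D. x \<le> i} = D" by (auto simp: C_def D_def)
      show ?thesis unfolding f_def eqs using pos by (simp add: Y_def)
    qed
  qed
  then show ?thesis using \<open>m > 0\<close> by (simp add: inverse_ennreal)
qed

text \<open>The indicator function of \<open>x\<close> has energy equal to the degree of \<open>x\<close>. For small radii this
  crude bound is enough.\<close>

lemma R_eff_sets_ge_degree:
  assumes "x \<notin> B"
  shows "inverse (num_edges \<omega> x) \<le> R_eff_sets \<omega> {x} B"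
proof (rule R_eff_sets_geI[where f = "indicator {x}"])
  let ?E = "{e \<in> pairs. x \<in> e \<and> \<omega> e}"
  let ?N = "{y. adj \<omega> x y}"
  show "energy \<omega> (indicator {x}) \<le> num_edges \<omega> x"
  proof (cases "finite ?E")
    case True
    have E: "?E = (\<lambda>y. {x, y}) ` ?N"
      unfolding pairs_def adj_def by (force simp: insert_commute)
    have inj: "inj_on (\<lambda>y. {x, y}) ?N"
      by (auto simp: inj_on_def doubleton_eq_iff)
    have fin: "finite ?N" using True inj by (simp add: E finite_image_iff)
    have "card ?N = card ?E" unfolding E using inj by (simp add: card_image)
    moreover have "energy \<omega> (indicator {x})
        = ennreal ((\<Sum>(a, b)\<in>({x} \<times> ?N \<union> ?N \<times> {x}). (indicator {x} a - indicator {x} b)\<^sup>2) / 2)"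
      using fin by (intro energy_finite_support)
        (auto simp: adj_def insert_commute indicator_def split: if_splits)
    moreover have "(\<Sum>(a, b)\<in>({x} \<times> ?N \<union> ?N \<times> {x}). (indicator {x} a - indicator {x} b)\<^sup>2)
        = (\<Sum>(a, b)\<in>({x} \<times> ?N \<union> ?N \<times> {x}). 1 :: real)"
      by (intro sum.cong) (auto simp: adj_def)
    moreover have "\<dots> = real (card ({x} \<times> ?N \<union> ?N \<times> {x}))" by (simp add: case_prod_beta)
    moreover have "card ({x} \<times> ?N \<union> ?N \<times> {x}) = card ({x} \<times> ?N) + card (?N \<times> {x})"
      using fin by (intro card_Un_disjoint) (auto simp: adj_def)
    ultimately show ?thesis
      using True by (simp add: num_edges_def emeasure_count_space ennreal_of_nat_eq_real_of_nat
          card_cartesian_product)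
  next
    case False
    then show ?thesis by (simp add: num_edges_def emeasure_count_space)
  qed
qed (use assms in \<open>auto simp: indicator_def\<close>)


section \<open>Measurability of volumes and resistances\<close>

lemma doubleton_in_pairs [simp]: "{x, y} \<in> pairs \<longleftrightarrow> x \<noteq> y"
  by (auto simp: pairs_def doubleton_eq_iff)

lemma edge_measurable [measurable]:
  assumes "e \<in> pairs"
  shows "Measurable.pred (long_range_percolation p) (\<lambda>\<omega>. \<omega> e)"
proof -
  have "(\<lambda>\<omega>. \<omega> e) \<in> measurable (long_range_percolation p) (measure_pmf (bernoulli_pmf (p (nat (Max e - Min e)))))"
    unfolding long_range_percolation_def using assms by (rule measurable_component_singleton)
  also have "\<dots> = measurable (long_range_percolation p) (count_space UNIV)"
    by (intro measurable_cong_sets) auto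
  finally show ?thesis .
qed

text \<open>The energy inside a finite box is a function of a finite set of edges, \<open>open_edges n \<omega>\<close>. It is
  kept as a function of that set, rather than of \<open>\<omega>\<close>, so that measurability in \<open>\<omega>\<close> reduces to a
  discrete space.\<close>

definition open_edges :: "nat \<Rightarrow> configuration \<Rightarrow> int set set" where
  "open_edges n \<omega> = {e \<in> pairs. e \<subseteq> {- int n..int n} \<and> \<omega> e}"

definition box_energy :: "nat \<Rightarrow> int set set \<Rightarrow> (int \<Rightarrow> real) \<Rightarrow> real" where
  "box_energy n E f =
     (\<Sum>(x, y)\<in>{- int n..int n} \<times> {- int n..int n}. of_bool ({x, y} \<in> E) * (f x - f y)\<^sup>2) / 2"

lemma energy_eq_SUP_box_energy:
  "energy \<omega> f = (SUP n. ennreal (box_energy n (open_edges n \<omega>) f))"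
proof -
  define Q where "Q n = {- int n..int n} \<times> {- int n..int n}" for n
  define A where "A = {(x, y). adj \<omega> x y}"
  define h where "h n = (\<lambda>(x, y). ennreal (of_bool ({x, y} \<in> open_edges n \<omega>) * (f x - f y)\<^sup>2))" for n
  have oe: "{x, y} \<in> open_edges n \<omega> \<longleftrightarrow> adj \<omega> x y \<and> (x, y) \<in> Q n" for x y n
    by (auto simp: open_edges_def adj_def Q_def)
  have inc: "incseq h"
    unfolding incseq_def le_fun_def h_def oe
    by (auto simp: Q_def intro!: ennreal_leI)
  have SUP_h: "(SUP n. h n z) = (case z of (x, y) \<Rightarrow> ennreal ((f x - f y)\<^sup>2)) * indicator A z" for z
  proof (rule antisym)
    show "(SUP n. h n z) \<le> (case z of (x, y) \<Rightarrow> ennreal ((f x - f y)\<^sup>2)) * indicator A z"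
      by (intro SUP_least) (auto simp: h_def oe A_def indicator_def split: prod.splits intro!: ennreal_leI)
    obtain x y where z: "z = (x, y)" by force
    have "(x, y) \<in> Q (nat (max \<bar>x\<bar> \<bar>y\<bar>))" by (auto simp: Q_def)
    then have "(case z of (x, y) \<Rightarrow> ennreal ((f x - f y)\<^sup>2)) * indicator A z \<le> h (nat (max \<bar>x\<bar> \<bar>y\<bar>)) z"
      by (auto simp: h_def oe A_def z indicator_def)
    then show "(case z of (x, y) \<Rightarrow> ennreal ((f x - f y)\<^sup>2)) * indicator A z \<le> (SUP n. h n z)"
      by (rule SUP_upper2[OF UNIV_I])
  qed
  have int_h: "(\<integral>\<^sup>+z. h n z \<partial>count_space UNIV) = ennreal (2 * box_energy n (open_edges n \<omega>) f)" for n
  proof -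
    have "(\<integral>\<^sup>+z. h n z \<partial>count_space UNIV) = (\<Sum>z\<in>Q n. h n z)"
      by (intro nn_integral_count_space') (auto simp: Q_def h_def oe)
    also have "\<dots> = ennreal (\<Sum>(x, y)\<in>Q n. of_bool ({x, y} \<in> open_edges n \<omega>) * (f x - f y)\<^sup>2)"
      unfolding h_def by (subst sum_ennreal[symmetric]) (auto simp: case_prod_beta)
    finally show ?thesis by (simp add: box_energy_def Q_def)
  qed
  have "energy \<omega> f = (\<integral>\<^sup>+z. (SUP n. h n z) \<partial>count_space UNIV) / 2"
    unfolding energy_def A_def[symmetric] SUP_h by (subst nn_integral_count_space_indicator) auto
  also have "\<dots> = (SUP n. ennreal (2 * box_energy n (open_edges n \<omega>) f)) / 2"
    using inc by (subst nn_integral_monotone_convergence_SUP) (simp_all add: int_h)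
  also have "\<dots> = (SUP n. ennreal (2 * box_energy n (open_edges n \<omega>) f) / 2)"
    by (rule SUP_divide_ennreal)
  also have "\<dots> = (SUP n. ennreal (box_energy n (open_edges n \<omega>) f))"
    by (subst ennreal_divide_numeral) (auto simp: box_energy_def intro!: sum_nonneg)
  finally show ?thesis .
qed

lemma box_energy_mono:
  assumes "m \<le> n"
  shows "box_energy m (open_edges m \<omega>) f \<le> box_energy n (open_edges n \<omega>) f"
proof -
  let ?Q = "\<lambda>n. {- int n..int n} \<times> {- int n..int n}"
  have "(\<Sum>(x, y)\<in>?Q m. of_bool ({x, y} \<in> open_edges m \<omega>) * (f x - f y)\<^sup>2)
      \<le> (\<Sum>(x, y)\<in>?Q m. of_bool ({x, y} \<in> open_edges n \<omega>) * (f x - f y)\<^sup>2)"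
    using assms by (intro sum_mono) (auto simp: open_edges_def)
  also have "\<dots> \<le> (\<Sum>(x, y)\<in>?Q n. of_bool ({x, y} \<in> open_edges n \<omega>) * (f x - f y)\<^sup>2)"
    using assms by (intro sum_mono2) auto
  finally show ?thesis by (simp add: box_energy_def)
qed

lemma continuous_box_energy: "continuous_on UNIV (box_energy n E)"
  unfolding box_energy_def case_prod_beta
  by (intro continuous_intros continuous_on_product_then_coordinatewise[OF continuous_on_id]) simp

definition unit_potentials :: "int set \<Rightarrow> int set \<Rightarrow> (int \<Rightarrow> real) set" where
  "unit_potentials A B = Pi\<^sub>E UNIV (\<lambda>x. {t \<in> {0..1}. (x \<in> A \<longrightarrow> t = 1) \<and> (x \<in> B \<longrightarrow> t = 0)})"

lemma unit_potentials_iff: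
  "f \<in> unit_potentials A B \<longleftrightarrow> (\<forall>x. 0 \<le> f x \<and> f x \<le> 1) \<and> (\<forall>x\<in>A. f x = 1) \<and> (\<forall>x\<in>B. f x = 0)"
  by (auto simp: unit_potentials_def PiE_iff)

lemma compact_unit_potentials: "compact (unit_potentials A B)"
proof -
  let ?S = "\<lambda>x. {t \<in> {0..1::real}. (x \<in> A \<longrightarrow> t = 1) \<and> (x \<in> B \<longrightarrow> t = 0)}"
  have "compact (?S x)" for x
  proof -
    have "?S x = {0..1} \<inter> (if x \<in> A then {1} else UNIV) \<inter> (if x \<in> B then {0} else UNIV)" by auto
    then show ?thesis by auto
  qed
  then have "compactin (product_topology (\<lambda>_. euclidean) UNIV) (Pi\<^sub>E UNIV ?S)"
    by (simp add: compactin_PiE)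
  then show ?thesis
    by (simp add: euclidean_product_topology unit_potentials_def)
qed

text \<open>Clamping a potential to \<open>[0, 1]\<close> lowers its energy, and the clamped potentials form a compact
  set by Tychonoff's theorem. Near-minimisers of the box energies therefore have a common limit,
  whose full energy is controlled by lower semicontinuity. This writes the infimum over an
  uncountable family as a countable supremum of quantities that each depend on finitely many
  edges, which is what makes the resistance a random variable.\<close>

lemma INF_energy_eq_SUP_box:
  "(INF f \<in> {f. (\<forall>x\<in>A. f x = 1) \<and> (\<forall>x\<in>B. f x = 0)}. energy \<omega> f)
     = (SUP n. INF f \<in> unit_potentials A B. ennreal (box_energy n (open_edges n \<omega>) f))"
  (is "?L = ?R")
proof (rule antisym)
  show "?R \<le> ?L"
  proof (intro SUP_least INF_greatest)
    fix n and f :: "int \<Rightarrow> real"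
    assume f: "f \<in> {f. (\<forall>x\<in>A. f x = 1) \<and> (\<forall>x\<in>B. f x = 0)}"
    define g where "g x = max 0 (min 1 (f x))" for x
    have "g \<in> unit_potentials A B" using f by (auto simp: unit_potentials_iff g_def)
    moreover have "box_energy n (open_edges n \<omega>) g \<le> box_energy n (open_edges n \<omega>) f"
    proof -
      have "(g x - g y)\<^sup>2 \<le> (f x - f y)\<^sup>2" for x y
        by (rule abs_le_square_iff[THEN iffD1]) (auto simp: g_def max_def min_def abs_if)
      then show ?thesis
        unfolding box_energy_def by (intro divide_right_mono sum_mono) auto
    qed
    moreover have "ennreal (box_energy n (open_edges n \<omega>) f) \<le> energy \<omega> f"
      unfolding energy_eq_SUP_box_energy by (rule SUP_upper) auto
    ultimately show "(INF f\<in>unit_potentials A B. ennreal (box_energy n (open_edges n \<omega>) f)) \<le> energy \<omega> f"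
      by (meson INF_lower2 ennreal_leI order_trans)
  qed
  show "?L \<le> ?R"
  proof (rule dense_ge)
    fix c assume c: "?R < c"
    let ?K = "\<lambda>n. {f. ennreal (box_energy n (open_edges n \<omega>) f) \<le> c}"
    have "unit_potentials A B \<inter> (\<Inter>n\<in>UNIV. ?K n) \<noteq> {}"
    proof (rule compact_imp_fip_image[OF compact_unit_potentials])
      show "closed (?K n)" for n
        by (intro closed_Collect_le continuous_on_ennreal continuous_box_energy continuous_on_const)
    next
      fix I :: "nat set" assume "finite I"
      define n where "n = Max (insert 0 I)"
      have le: "m \<le> n" if "m \<in> I" for m
        using that \<open>finite I\<close> by (simp add: n_def)
      have "(INF f\<in>unit_potentials A B. ennreal (box_energy n (open_edges n \<omega>) f)) < c"
        using c by (rule le_less_trans[rotated]) (auto intro: SUP_upper)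
      then obtain f where f: "f \<in> unit_potentials A B" "ennreal (box_energy n (open_edges n \<omega>) f) < c"
        by (auto simp: INF_less_iff)
      have "f \<in> ?K m" if "m \<in> I" for m
        using f(2) ennreal_leI[OF box_energy_mono[OF le[OF that]], of \<omega> f] by auto
      with f(1) show "unit_potentials A B \<inter> (\<Inter>n\<in>I. ?K n) \<noteq> {}" by blast
    qed
    then obtain f where f: "f \<in> unit_potentials A B"
      and le: "\<And>n. ennreal (box_energy n (open_edges n \<omega>) f) \<le> c" by auto
    have "energy \<omega> f \<le> c"
      unfolding energy_eq_SUP_box_energy using le by (intro SUP_least)
    then show "?L \<le> c"
      using f by (intro INF_lower2[of f]) (auto simp: unit_potentials_iff)
  qed
qed

lemma open_edges_measurable [measurable]:
  "open_edges n \<in> measurable (long_range_percolation p) (count_space (Pow {e \<in> pairs. e \<subseteq> {- int n..int n}}))"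
    (is "_ \<in> measurable _ (count_space (Pow ?P))")
proof -
  have fin: "finite ?P" by (rule finite_subset[of _ "Pow {- int n..int n}"]) auto
  show ?thesis
    unfolding measurable_count_space_eq2[OF finite_Pow_iff[THEN iffD2, OF fin]]
  proof (intro conjI ballI)
    show "open_edges n \<in> space (long_range_percolation p) \<rightarrow> Pow ?P"
      unfolding open_edges_def by blast
    fix E assume E: "E \<in> Pow ?P"
    have "open_edges n \<omega> = E \<longleftrightarrow> (\<forall>e\<in>?P. \<omega> e \<longleftrightarrow> e \<in> E)" for \<omega>
      using E unfolding open_edges_def by blast
    then have "open_edges n -` {E} \<inter> space (long_range_percolation p)
        = {\<omega> \<in> space (long_range_percolation p). \<forall>e\<in>?P. \<omega> e \<longleftrightarrow> e \<in> E}"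
      by (simp only: vimage_def Int_def mem_Collect_eq singleton_iff conj_commute)
    also have "\<dots> \<in> sets (long_range_percolation p)"
    proof (intro sets.sets_Collect_finite_All fin)
      fix e assume "e \<in> ?P"
      then have [measurable]: "Measurable.pred (long_range_percolation p) (\<lambda>\<omega>. \<omega> e)"
        by (intro edge_measurable) simp
      show "{\<omega> \<in> space (long_range_percolation p). \<omega> e \<longleftrightarrow> e \<in> E} \<in> sets (long_range_percolation p)"
        by measurable
    qed
    finally show "open_edges n -` {E} \<inter> space (long_range_percolation p) \<in> sets (long_range_percolation p)" .
  qed
qed

lemma R_eff_sets_measurable [measurable]:
  "(\<lambda>\<omega>. R_eff_sets \<omega> A B) \<in> borel_measurable (long_range_percolation p)"
proof -
  have "(\<lambda>\<omega>. INF f \<in> unit_potentials A B. ennreal (box_energy n (open_edges n \<omega>) f))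
      \<in> borel_measurable (long_range_percolation p)" for n
    by (rule measurable_compose[OF open_edges_measurable]) simp
  then show ?thesis
    unfolding R_eff_sets_alt INF_energy_eq_SUP_box by measurable
qed

text \<open>The edges at \<open>x\<close> are enumerated by their length \<open>n + 1\<close>, one in each direction.\<close>

lemma num_edges_eq_suminf:
  "num_edges \<omega> x = (\<Sum>n. of_bool (\<omega> {x, x + int (Suc n)}) + of_bool (\<omega> {x, x - int (Suc n)}))"
proof -
  define E where "E n = {e \<in> {{x, x + int (Suc n)}, {x, x - int (Suc n)}}. \<omega> e}" for n
  have disj: "disjoint_family E"
    by (auto simp: disjoint_family_on_def E_def doubleton_eq_iff)
  have "{e \<in> pairs. x \<in> e \<and> \<omega> e} \<subseteq> (\<Union>n. E n)"
  proof
    fix e assume e: "e \<in> {e \<in> pairs. x \<in> e \<and> \<omega> e}"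
    then obtain y where y: "e = {x, y}" "x \<noteq> y"
      unfolding pairs_def by blast
    then have "e \<in> E (nat (\<bar>y - x\<bar> - 1))"
      using e by (cases "x < y") (auto simp: E_def)
    then show "e \<in> (\<Union>n. E n)" by blast
  qed
  then have "{e \<in> pairs. x \<in> e \<and> \<omega> e} = (\<Union>n. E n)"
    by (auto simp: E_def)
  then have "num_edges \<omega> x = (\<Sum>n. emeasure (count_space UNIV) (E n))"
    unfolding num_edges_def using disj by (subst suminf_emeasure) auto
  moreover have "emeasure (count_space UNIV) (E n)
      = of_bool (\<omega> {x, x + int (Suc n)}) + of_bool (\<omega> {x, x - int (Suc n)})" for n
  proof -
    let ?u = "{x, x + int (Suc n)}" and ?d = "{x, x - int (Suc n)}"
    have ne: "?u \<noteq> ?d" by (auto simp: doubleton_eq_iff)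
    have "E n = (if \<omega> ?u then {?u} else {}) \<union> (if \<omega> ?d then {?d} else {})"
      unfolding E_def by auto
    then show ?thesis using ne by (simp add: emeasure_count_space)
  qed
  ultimately show ?thesis by simp
qed

lemma num_edges_measurable [measurable]:
  "(\<lambda>\<omega>. num_edges \<omega> x) \<in> borel_measurable (long_range_percolation p)"
proof -
  have [measurable]: "Measurable.pred (long_range_percolation p) (\<lambda>\<omega>. \<omega> {x, x + int (Suc n)})"
    "Measurable.pred (long_range_percolation p) (\<lambda>\<omega>. \<omega> {x, x - int (Suc n)})" for n
    by (rule edge_measurable, simp)+
  show ?thesis unfolding num_edges_eq_suminf of_bool_def by measurable
qed

lemma open_ball_real: "open_ball (ennreal R) = {- \<lceil>R\<rceil><..<\<lceil>R\<rceil>}"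
proof -
  have "ennreal (real_of_int \<bar>y\<bar>) < ennreal R \<longleftrightarrow> - \<lceil>R\<rceil> < y \<and> y < \<lceil>R\<rceil>" for y
    by (subst ennreal_less_iff) (simp, linarith)
  then show ?thesis
    by (simp only: open_ball_def set_eq_iff mem_Collect_eq greaterThanLessThan_iff simp_thms)
qed

lemma ball_vol_real: "ball_vol \<omega> (ennreal R) = (\<Sum>x\<in>{- \<lceil>R\<rceil><..<\<lceil>R\<rceil>}. num_edges \<omega> x)"
proof -
  have "ball_vol \<omega> (ennreal R)
      = (\<integral>\<^sup>+x. num_edges \<omega> x * indicator (open_ball (ennreal R)) x \<partial>count_space UNIV)"
    unfolding ball_vol_def vertex_measure_def by (rule emeasure_density) auto
  also have "\<dots> = (\<Sum>x\<in>open_ball (ennreal R). num_edges \<omega> x * indicator (open_ball (ennreal R)) x)"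
    by (rule nn_integral_count_space') (auto simp: open_ball_real)
  finally show ?thesis by (simp add: open_ball_real)
qed

lemma ball_vol_measurable [measurable]:
  "(\<lambda>\<omega>. ball_vol \<omega> (ennreal R)) \<in> borel_measurable (long_range_percolation p)"
  unfolding ball_vol_real by (intro borel_measurable_sum num_edges_measurable)

lemma J_measurable:
  "{\<omega> \<in> space (long_range_percolation p). ennreal R \<in> J \<omega> lam} \<in> sets (long_range_percolation p)"
proof -
  have [measurable]: "(\<lambda>\<omega>. R_eff \<omega> 0 y) \<in> borel_measurable (long_range_percolation p)" for y
    unfolding R_eff_def using R_eff_sets_measurable by (cases "y = 0") simp_all
  show ?thesis
    unfolding J_def mem_Collect_eq by measurable
qed


section \<open>Sums of finitely dependent indicators\<close>

lemma (in prob_space) prob_ge_le_of_nn_integral: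
  assumes [measurable]: "u \<in> borel_measurable M" and "(\<integral>\<^sup>+\<omega>. u \<omega> \<partial>M) \<le> ennreal d" "t > 0" "d \<ge> 0"
  shows "prob {\<omega> \<in> space M. ennreal t \<le> u \<omega>} \<le> d / t"
proof -
  have "ennreal t \<le> v \<longleftrightarrow> 1 \<le> ennreal (1 / t) * v" for v
    using \<open>t > 0\<close> by (cases v) (simp_all add: ennreal_mult[symmetric] ennreal_mult_top field_simps
        flip: ennreal_1)
  then have "{\<omega> \<in> space M. ennreal t \<le> u \<omega>} = {\<omega> \<in> space M. 1 \<le> ennreal (1 / t) * u \<omega>}"
    by simp
  then have "emeasure M {\<omega> \<in> space M. ennreal t \<le> u \<omega>} \<le> ennreal (1 / t) * (\<integral>\<^sup>+\<omega>. u \<omega> \<partial>M)"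
    using nn_integral_Markov_inequality[of u "space M" M "ennreal (1 / t)"]
    by (simp add: indicator_def cong: nn_integral_cong)
  also have "\<dots> \<le> ennreal (1 / t) * ennreal d" by (intro mult_left_mono assms) auto
  also have "\<dots> = ennreal (d / t)" using assms by (simp add: ennreal_mult[symmetric])
  finally show ?thesis using assms by (simp add: emeasure_eq_measure)
qed

text \<open>Chebyshev's inequality: only pairs of indices at distance less than \<open>L\<close> contribute to the
  variance, and there are at most \<open>2 L\<close> of them per index.\<close>

lemma (in prob_space) prob_few_finitely_dependent_events:
  fixes A :: "int \<Rightarrow> 'a set" and L :: nat and a t :: real
  assumes "finite I" and A [measurable]: "\<And>i. A i \<in> sets M"
    and prob_A: "\<And>i. i \<in> I \<Longrightarrow> prob (A i) = a"
    and indep: "\<And>i j. i \<in> I \<Longrightarrow> j \<in> I \<Longrightarrow> i + int L \<le> j \<Longrightarrow> prob (A i \<inter> A j) = a\<^sup>2"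
    and "t > 0"
  shows "prob {\<omega> \<in> space M. (\<Sum>i\<in>I. indicator (A i) \<omega>) \<le> a * card I - t} \<le> 2 * L * card I / t\<^sup>2"
proof -
  define X where "X \<omega> = (\<Sum>i\<in>I. indicator (A i) \<omega> :: real)" for \<omega>
  have [measurable]: "X \<in> borel_measurable M" unfolding X_def by measurable
  have X_le: "0 \<le> X \<omega>" "X \<omega> \<le> card I" for \<omega>
    unfolding X_def using sum_mono[of I "\<lambda>i. indicator (A i) \<omega>" "\<lambda>_. 1::real"]
    by (auto intro!: sum_nonneg simp: indicator_def)
  have int_X: "integrable M X"
    using X_le by (intro integrable_const_bound[where B = "card I"]) auto
  have int_X2: "integrable M (\<lambda>\<omega>. (X \<omega>)\<^sup>2)"
    using X_le by (intro integrable_const_bound[where B = "(card I)\<^sup>2"]) (auto intro!: power_mono)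
  have int_ind: "integrable M (indicat_real B)" if "B \<in> sets M" for B
    using that by (intro integrable_real_indicator) (auto simp: emeasure_eq_measure)
  have EX: "expectation X = a * card I"
    unfolding X_def by (subst Bochner_Integration.integral_sum) (auto simp: prob_A int_ind)
  have X2: "(X \<omega>)\<^sup>2 = (\<Sum>i\<in>I. \<Sum>j\<in>I. indicator (A i \<inter> A j) \<omega>)" for \<omega>
    by (simp add: X_def power2_eq_square sum_product indicator_inter_arith)
  have EX2: "expectation (\<lambda>\<omega>. (X \<omega>)\<^sup>2) = (\<Sum>i\<in>I. \<Sum>j\<in>I. prob (A i \<inter> A j))"
    unfolding X2 by (simp add: int_ind)
  have "variance X = expectation (\<lambda>\<omega>. (X \<omega>)\<^sup>2) - (expectation X)\<^sup>2"
    by (rule variance_eq[OF int_X int_X2])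
  also have "\<dots> = (\<Sum>i\<in>I. \<Sum>j\<in>I. prob (A i \<inter> A j) - a\<^sup>2)"
    unfolding EX EX2 by (simp add: sum_subtractf power2_eq_square mult_ac)
  also have "\<dots> \<le> (\<Sum>i\<in>I. \<Sum>j\<in>I. of_bool (j \<in> {i - int L<..<i + int L}))"
  proof (intro sum_mono)
    fix i j assume ij: "i \<in> I" "j \<in> I"
    have "prob (A i \<inter> A j) = a\<^sup>2" if "j \<notin> {i - int L<..<i + int L}"
      using that indep[of i j] indep[of j i] ij by (auto simp: Int_commute)
    moreover have "prob (A i \<inter> A j) - a\<^sup>2 \<le> 1"
      using prob_le_1[of "A i \<inter> A j"] zero_le_power2[of a] by linarith
    ultimately show "prob (A i \<inter> A j) - a\<^sup>2 \<le> of_bool (j \<in> {i - int L<..<i + int L})"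
      by (cases "j \<in> {i - int L<..<i + int L}") auto
  qed
  also have "\<dots> = (\<Sum>i\<in>I. real (card (I \<inter> {i - int L<..<i + int L})))"
    using \<open>finite I\<close> by (simp add: sum.If_cases of_bool_def Int_def)
  also have "\<dots> \<le> (\<Sum>i\<in>I. real (2 * L))"
  proof (intro sum_mono of_nat_mono)
    fix i
    have "card (I \<inter> {i - int L<..<i + int L}) \<le> card {i - int L<..<i + int L}"
      by (intro card_mono) auto
    also have "\<dots> \<le> 2 * L" by simp
    finally show "card (I \<inter> {i - int L<..<i + int L}) \<le> 2 * L" .
  qed
  finally have var: "variance X \<le> 2 * L * card I" by (simp add: mult_ac)
  have "prob {\<omega> \<in> space M. X \<omega> \<le> a * card I - t}
      \<le> prob {\<omega> \<in> space M. t \<le> \<bar>X \<omega> - expectation X\<bar>}"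
    unfolding EX by (intro finite_measure_mono) auto
  also have "\<dots> \<le> variance X / t\<^sup>2"
    using \<open>t > 0\<close> int_X2 by (intro Chebyshev_inequality) auto
  also have "\<dots> \<le> 2 * L * card I / t\<^sup>2"
    using var by (intro divide_right_mono) auto
  finally show ?thesis by (simp add: X_def)
qed

section \<open>Edge probabilities\<close>

locale long_range_profile =
  fixes p :: "nat \<Rightarrow> real" and s K :: real
  assumes s: "s > 2" and p1: "p 1 = 1"
    and p_range: "\<And>n. n \<ge> 2 \<Longrightarrow> 0 \<le> p n \<and> p n < 1"
    and p_le: "\<And>n. n \<ge> 1 \<Longrightarrow> p n \<le> K * real n powr - s"
begin

abbreviation "M \<equiv> long_range_percolation p"

sublocale prob_space M
  unfolding long_range_percolation_def by (intro prob_space_PiM prob_space_measure_pmf)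

lemma p_01: "n \<ge> 1 \<Longrightarrow> 0 \<le> p n \<and> p n \<le> 1"
  using p1 p_range[of n] by (cases "n = 1") auto

lemma edge_length_01: "e \<in> pairs \<Longrightarrow> 0 \<le> p (nat (Max e - Min e)) \<and> p (nat (Max e - Min e)) \<le> 1"
  by (rule p_01) (auto simp: pairs_def max_def min_def)

lemma prob_all_closed:
  assumes "finite F" "F \<subseteq> pairs"
  shows "prob {\<omega> \<in> space M. \<forall>e\<in>F. \<not> \<omega> e} = (\<Prod>e\<in>F. 1 - p (nat (Max e - Min e)))"
proof -
  let ?B = "\<lambda>e. measure_pmf (bernoulli_pmf (p (nat (Max e - Min e))))"
  interpret P: product_prob_space ?B pairs
    by unfold_locales
  have "{\<omega> \<in> space M. \<forall>e\<in>F. \<not> \<omega> e} = {\<omega> \<in> space (PiM pairs ?B). \<forall>e\<in>F. \<omega> e \<in> {False}}"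
    by (auto simp: long_range_percolation_def)
  then have "emeasure M {\<omega> \<in> space M. \<forall>e\<in>F. \<not> \<omega> e} = (\<Prod>e\<in>F. emeasure (?B e) {False})"
    using assms P.emeasure_PiM_Collect[of F "\<lambda>_. {False}"]
    by (simp add: long_range_percolation_def)
  also have "\<dots> = (\<Prod>e\<in>F. ennreal (1 - p (nat (Max e - Min e))))"
    using assms edge_length_01 by (intro prod.cong) (auto simp: emeasure_pmf_single)
  also have "\<dots> = ennreal (\<Prod>e\<in>F. 1 - p (nat (Max e - Min e)))"
    using assms edge_length_01 by (intro prod_ennreal) auto
  finally show ?thesis
    using assms edge_length_01 by (simp add: emeasure_eq_measure) (meson ennreal_inj measure_nonneg prod_nonneg diff_ge_0_iff_ge subsetD)
qed

lemma prob_edge: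
  assumes "x < y"
  shows "prob {\<omega> \<in> space M. \<omega> {x, y}} = p (nat (y - x))"
proof -
  have [measurable]: "Measurable.pred M (\<lambda>\<omega>. \<omega> {x, y})"
    using assms by (intro edge_measurable) auto
  have "{\<omega> \<in> space M. \<omega> {x, y}} = space M - {\<omega> \<in> space M. \<forall>e\<in>{{x, y}}. \<not> \<omega> e}" by auto
  then have "prob {\<omega> \<in> space M. \<omega> {x, y}} = 1 - prob {\<omega> \<in> space M. \<forall>e\<in>{{x, y}}. \<not> \<omega> e}"
    by (simp add: prob_compl)
  then show ?thesis
    using assms by (subst (asm) prob_all_closed) (auto simp: max_def min_def)
qed

lemma AE_nearest_neighbour: "AE \<omega> in M. \<forall>i. \<omega> {i, i + 1}"
proof (subst AE_all_countable, rule allI)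
  fix i :: int
  have "prob {\<omega> \<in> space M. \<omega> {i, i + 1}} = 1"
    using p1 by (simp add: prob_edge)
  from AE_prob_1[OF this] show "AE \<omega> in M. \<omega> {i, i + 1}" by auto
qed

lemma K_nonneg: "K \<ge> 0"
  using p_le[of 1] p1 by simp

lemma summable_p: "summable (\<lambda>n. p (Suc n))"
proof (rule summable_comparison_test')
  show "summable (\<lambda>n. K * real (Suc n) powr - s)"
    using s by (intro summable_mult) (subst summable_Suc_iff, simp add: summable_real_powr_iff)
  show "norm (p (Suc n)) \<le> K * real (Suc n) powr - s" for n
    using p_le[of "Suc n"] p_01[of "Suc n"] by simp
qed

definition mean_degree :: real where
  "mean_degree = 2 * (\<Sum>n. p (Suc n))"

lemma mean_degree_nonneg: "mean_degree \<ge> 0"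
  unfolding mean_degree_def using summable_p p_01 by (intro mult_nonneg_nonneg suminf_nonneg) auto

lemma nn_integral_num_edges: "(\<integral>\<^sup>+\<omega>. num_edges \<omega> x \<partial>M) = ennreal mean_degree"
proof -
  have [measurable]: "Measurable.pred M (\<lambda>\<omega>. \<omega> {x, x + int (Suc n)})"
    "Measurable.pred M (\<lambda>\<omega>. \<omega> {x, x - int (Suc n)})" for n
    by (rule edge_measurable, simp)+
  have edge: "(\<integral>\<^sup>+\<omega>. of_bool (\<omega> {a, b}) \<partial>M) = ennreal (p (nat (b - a)))" if "a < b" for a b
  proof -
    have [measurable]: "Measurable.pred M (\<lambda>\<omega>. \<omega> {a, b})"
      using that by (intro edge_measurable) simp
    have "(\<integral>\<^sup>+\<omega>. of_bool (\<omega> {a, b}) \<partial>M) = (\<integral>\<^sup>+\<omega>. indicator {\<omega> \<in> space M. \<omega> {a, b}} \<omega> \<partial>M)"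
      by (intro nn_integral_cong) (auto simp: indicator_def)
    also have "\<dots> = emeasure M {\<omega> \<in> space M. \<omega> {a, b}}"
      by (rule nn_integral_indicator) measurable
    also have "\<dots> = ennreal (p (nat (b - a)))"
      using that by (simp add: emeasure_eq_measure prob_edge)
    finally show ?thesis .
  qed
  have "(\<integral>\<^sup>+\<omega>. num_edges \<omega> x \<partial>M)
      = (\<Sum>n. \<integral>\<^sup>+\<omega>. of_bool (\<omega> {x, x + int (Suc n)}) + of_bool (\<omega> {x, x - int (Suc n)}) \<partial>M)"
    unfolding num_edges_eq_suminf by (rule nn_integral_suminf) (unfold of_bool_def, measurable)
  also have "\<dots> = (\<Sum>n. ennreal (p (Suc n)) + ennreal (p (Suc n)))"
  proof (intro suminf_cong)
    fix n
    have "(\<integral>\<^sup>+\<omega>. of_bool (\<omega> {x, x + int (Suc n)}) + of_bool (\<omega> {x, x - int (Suc n)}) \<partial>M)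
        = (\<integral>\<^sup>+\<omega>. of_bool (\<omega> {x, x + int (Suc n)}) \<partial>M) + (\<integral>\<^sup>+\<omega>. of_bool (\<omega> {x, x - int (Suc n)}) \<partial>M)"
      by (rule nn_integral_add) (unfold of_bool_def, measurable)
    moreover have "(\<integral>\<^sup>+\<omega>. of_bool (\<omega> {x, x + int (Suc n)}) \<partial>M) = ennreal (p (Suc n))"
      using edge[of x "x + int (Suc n)"] by (simp add: nat_add_distrib)
    moreover have "(\<integral>\<^sup>+\<omega>. of_bool (\<omega> {x, x - int (Suc n)}) \<partial>M) = ennreal (p (Suc n))"
      using edge[of "x - int (Suc n)" x] by (simp add: nat_add_distrib insert_commute)
    ultimately show "(\<integral>\<^sup>+\<omega>. of_bool (\<omega> {x, x + int (Suc n)}) + of_bool (\<omega> {x, x - int (Suc n)}) \<partial>M)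
        = ennreal (p (Suc n)) + ennreal (p (Suc n))" by simp
  qed
  also have "\<dots> = (\<Sum>n. ennreal (2 * p (Suc n)))"
    using p_01 by (intro suminf_cong) (simp flip: ennreal_plus)
  also have "\<dots> = ennreal mean_degree"
    unfolding mean_degree_def using summable_p p_01
    by (subst suminf_ennreal2) (auto simp: suminf_mult intro!: summable_mult)
  finally show ?thesis .
qed

lemma nn_integral_ball_vol:
  assumes "R \<ge> 1"
  shows "(\<integral>\<^sup>+\<omega>. ball_vol \<omega> (ennreal R) \<partial>M) \<le> ennreal (4 * mean_degree * R)"
proof -
  have "(\<integral>\<^sup>+\<omega>. ball_vol \<omega> (ennreal R) \<partial>M) = (\<Sum>x\<in>{- \<lceil>R\<rceil><..<\<lceil>R\<rceil>}. ennreal mean_degree)"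
    unfolding ball_vol_real by (subst nn_integral_sum) (auto simp: nn_integral_num_edges)
  also have "\<dots> = ennreal (card {- \<lceil>R\<rceil><..<\<lceil>R\<rceil>} * mean_degree)"
    using mean_degree_nonneg by (simp add: ennreal_mult ennreal_of_nat_eq_real_of_nat)
  also have "real (card {- \<lceil>R\<rceil><..<\<lceil>R\<rceil>}) * mean_degree \<le> (4 * R) * mean_degree"
  proof (intro mult_right_mono mean_degree_nonneg)
    have "real (card {- \<lceil>R\<rceil><..<\<lceil>R\<rceil>}) \<le> 2 * real_of_int \<lceil>R\<rceil>"
      using assms by simp
    also have "\<dots> \<le> 4 * R" using assms by linarith
    finally show "real (card {- \<lceil>R\<rceil><..<\<lceil>R\<rceil>}) \<le> 4 * R" .
  qed
  finally show ?thesis by (simp add: mult_ac ennreal_leI)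
qed

end


section \<open>Cut edges have positive density\<close>

text \<open>The pair \<open>(n, j)\<close> stands for the edge of length \<open>n\<close> with left endpoint \<open>i - j\<close>; it crosses
  \<open>(i, i+1)\<close> exactly if \<open>j < n\<close>. Length 1 is left out because that edge is \<open>(i, i+1)\<close> itself.\<close>

definition short_crossing_edges :: "int \<Rightarrow> nat \<Rightarrow> int set set" where
  "short_crossing_edges i L =
     (\<lambda>(n, j). {i - int j, i - int j + int n}) ` (SIGMA n:{2..L}. {..<n})"

definition long_crossed :: "nat \<Rightarrow> int \<Rightarrow> configuration \<Rightarrow> bool" where
  "long_crossed L i \<omega> \<longleftrightarrow> (\<exists>n>L. \<exists>j<n. \<omega> {i - int j, i - int j + int n})"

lemma inj_on_short_crossing:
  "inj_on (\<lambda>(n, j). {i - int j, i - int j + int n}) (SIGMA n:{2..L}. {..<n})"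
  by (auto simp: inj_on_def doubleton_eq_iff)

lemma finite_short_crossing_edges: "finite (short_crossing_edges i L)"
  by (simp add: short_crossing_edges_def)

lemma short_crossing_edges_pairs: "short_crossing_edges i L \<subseteq> pairs"
  by (auto simp: short_crossing_edges_def)

text \<open>An edge crossing both \<open>i\<close> and \<open>j\<close> is longer than \<open>j - i\<close>.\<close>

lemma short_crossing_edges_disjoint:
  assumes "i + int L \<le> j"
  shows "short_crossing_edges i L \<inter> short_crossing_edges j L = {}"
proof -
  have False if "{i - int a, i - int a + int n} = {j - int b, j - int b + int m}"
    "2 \<le> n" "2 \<le> m" "m \<le> L" "b < m" for a b n m
    using that assms unfolding doubleton_eq_iff by linarith
  then show ?thesis by (auto simp: short_crossing_edges_def)
qed

lemma cut_edgeI: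
  assumes "\<omega> {i, i + 1}" "\<forall>e\<in>short_crossing_edges i L. \<not> \<omega> e" "\<not> long_crossed L i \<omega>"
  shows "cut_edge \<omega> i"
  unfolding cut_edge_def
proof (intro conjI allI impI assms)
  fix x y assume xy: "x \<le> i" "i < y" "(x, y) \<noteq> (i, i + 1)"
  define n j where "n = nat (y - x)" and "j = nat (i - x)"
  have n: "n \<ge> 2" "j < n" and e: "{x, y} = {i - int j, i - int j + int n}"
    using xy by (auto simp: n_def j_def)
  show "\<not> \<omega> {x, y}"
  proof (cases "n \<le> L")
    case True
    then have "{x, y} \<in> short_crossing_edges i L"
      unfolding short_crossing_edges_def e using n by (intro image_eqI[of _ _ "(n, j)"]) auto
    then show ?thesis using assms by blast
  next
    case False
    then show ?thesis using assms n unfolding long_crossed_def e by auto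
  qed
qed

lemma cut_edge_measurable [measurable]:
  "Measurable.pred (long_range_percolation p) (\<lambda>\<omega>. cut_edge \<omega> i)"
proof -
  have [measurable]: "Measurable.pred (long_range_percolation p) (\<lambda>\<omega>. \<omega> {i, i + 1})"
    by (rule edge_measurable) simp
  have "Measurable.pred (long_range_percolation p)
      (\<lambda>\<omega>. x \<le> i \<longrightarrow> i < y \<longrightarrow> (x, y) \<noteq> (i, i + 1) \<longrightarrow> \<not> \<omega> {x, y})" for x y
    using edge_measurable[of "{x, y}" p] by (cases "x \<le> i \<and> i < y") auto
  then show ?thesis unfolding cut_edge_def by measurable
qed

lemma measurable_edge_gt [measurable]:
  "Measurable.pred (long_range_percolation p) (\<lambda>\<omega>. n > L \<and> \<omega> {x, x + int n})"
  by (cases "n > L") (auto intro!: edge_measurable)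

lemma long_crossed_measurable [measurable]:
  "Measurable.pred (long_range_percolation p) (long_crossed L i)"
proof -
  have "long_crossed L i = (\<lambda>\<omega>. \<exists>n. \<exists>j\<in>{..<n}. n > L \<and> \<omega> {i - int j, i - int j + int n})"
    by (auto simp: long_crossed_def fun_eq_iff)
  then show ?thesis by simp
qed

context long_range_profile
begin

lemma prob_no_short_crossing:
  "prob {\<omega> \<in> space M. \<forall>e\<in>short_crossing_edges i L. \<not> \<omega> e} = (\<Prod>n\<in>{2..L}. (1 - p n) ^ n)"
proof -
  have "prob {\<omega> \<in> space M. \<forall>e\<in>short_crossing_edges i L. \<not> \<omega> e}
      = (\<Prod>e\<in>short_crossing_edges i L. 1 - p (nat (Max e - Min e)))"
    by (intro prob_all_closed finite_short_crossing_edges short_crossing_edges_pairs)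
  also have "\<dots> = (\<Prod>(n, j)\<in>(SIGMA n:{2..L}. {..<n}). 1 - p n)"
    unfolding short_crossing_edges_def
    by (subst prod.reindex[OF inj_on_short_crossing]) (auto intro!: prod.cong)
  also have "\<dots> = (\<Prod>n\<in>{2..L}. \<Prod>j\<in>{..<n}. 1 - p n)"
    by (subst prod.Sigma) auto
  finally show ?thesis by simp
qed

lemma prob_no_short_crossing_indep:
  assumes "i + int L \<le> j"
  shows "prob ({\<omega> \<in> space M. \<forall>e\<in>short_crossing_edges i L. \<not> \<omega> e} \<inter>
               {\<omega> \<in> space M. \<forall>e\<in>short_crossing_edges j L. \<not> \<omega> e})
         = (\<Prod>n\<in>{2..L}. (1 - p n) ^ n)\<^sup>2"
proof -
  let ?S = "\<lambda>i. short_crossing_edges i L"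
  have eq: "{\<omega> \<in> space M. \<forall>e\<in>?S i. \<not> \<omega> e} \<inter> {\<omega> \<in> space M. \<forall>e\<in>?S j. \<not> \<omega> e}
      = {\<omega> \<in> space M. \<forall>e\<in>?S i \<union> ?S j. \<not> \<omega> e}" by auto
  have "prob \<dots> = (\<Prod>e\<in>?S i \<union> ?S j. 1 - p (nat (Max e - Min e)))"
    using finite_short_crossing_edges short_crossing_edges_pairs by (intro prob_all_closed) auto
  also have "\<dots> = (\<Prod>e\<in>?S i. 1 - p (nat (Max e - Min e))) * (\<Prod>e\<in>?S j. 1 - p (nat (Max e - Min e)))"
    using finite_short_crossing_edges short_crossing_edges_disjoint[OF assms]
    by (intro prod.union_disjoint) auto
  also have "\<dots> = (\<Prod>n\<in>{2..L}. (1 - p n) ^ n) * (\<Prod>n\<in>{2..L}. (1 - p n) ^ n)"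
    by (subst (1 2) prob_all_closed[symmetric])
      (auto simp: finite_short_crossing_edges prob_no_short_crossing
        dest: short_crossing_edges_pairs[THEN subsetD])
  finally show ?thesis unfolding eq by (simp add: power2_eq_square)
qed

text \<open>The tail of \<open>\<Sum>n. n p(n)\<close> beyond \<open>L\<close> has order \<open>L powr (2 - s)\<close>. Half of that exponent is
  given away: in \<open>n powr (1 - s) = n powr (- decay) * n powr (- s/2)\<close> the first factor is at most
  \<open>L powr (- decay)\<close> for \<open>n \<ge> L\<close> and the second one still has a finite sum, because \<open>s/2 > 1\<close>. This replaces
  tail estimates by comparison with one fixed series.\<close>

definition decay :: real where "decay = (s - 2) / 2"

definition crossing_mass :: real where
  "crossing_mass = K * (\<Sum>n. real n powr (- s / 2))"

lemma decay_pos: "decay > 0" using s by (simp add: decay_def)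

lemma summable_powr_half_s: "summable (\<lambda>n. real n powr (- s / 2))"
  using s by (simp add: summable_real_powr_iff)

lemma crossing_mass_nonneg: "crossing_mass \<ge> 0"
  unfolding crossing_mass_def using K_nonneg summable_powr_half_s
  by (intro mult_nonneg_nonneg suminf_nonneg) auto

lemma first_moment_le:
  assumes "1 \<le> L" "L \<le> n"
  shows "real n * p n \<le> K * real L powr - decay * real n powr (- s / 2)"
proof -
  have exponents: "1 + - s = - decay + - s / 2"
    by (simp add: decay_def field_simps)
  have "real n * p n \<le> real n * (K * real n powr - s)"
    using assms by (intro mult_left_mono p_le) auto
  also have "\<dots> = K * (real n powr 1 * real n powr - s)" using assms by simp
  also have "\<dots> = K * (real n powr - decay * real n powr (- s / 2))"
    by (simp only: powr_add[symmetric] exponents)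
  also have "\<dots> \<le> K * (real L powr - decay * real n powr (- s / 2))"
    using assms decay_pos K_nonneg
    by (intro mult_left_mono mult_right_mono powr_mono2') auto
  finally show ?thesis by (simp add: mult_ac)
qed

lemma summable_first_moment: "summable (\<lambda>n. real n * p n)"
proof (rule summable_comparison_test'[where N = 1])
  show "summable (\<lambda>n. K * real n powr (- s / 2))"
    by (intro summable_mult summable_powr_half_s)
  show "norm (real n * p n) \<le> K * real n powr (- s / 2)" if "n \<ge> 1" for n
    using first_moment_le[of 1 n] p_01[OF that] that by simp
qed

lemma prob_long_crossed:
  assumes "1 \<le> L"
  shows "prob {\<omega> \<in> space M. long_crossed L i \<omega>} \<le> crossing_mass * real L powr - decay"
proof -
  define S where "S n = {\<omega> \<in> space M. \<exists>j\<in>{..<n}. n > L \<and> \<omega> {i - int j, i - int j + int n}}" for n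
  have S [measurable]: "S n \<in> sets M" for n unfolding S_def by measurable
  let ?b = "\<lambda>n. K * real L powr - decay * real n powr (- s / 2)"
  have b_nonneg: "?b n \<ge> 0" for n using K_nonneg by simp
  have "emeasure M (S n) \<le> ennreal (?b n)" for n
  proof (cases "n > L")
    case True
    have "S n = (\<Union>j\<in>{..<n}. {\<omega> \<in> space M. \<omega> {i - int j, i - int j + int n}})"
      using True by (auto simp: S_def)
    also have "prob \<dots> \<le> (\<Sum>j\<in>{..<n}. prob {\<omega> \<in> space M. \<omega> {i - int j, i - int j + int n}})"
      using True edge_measurable[unfolded pred_def]
      by (intro finite_measure_subadditive_finite) auto
    also have "\<dots> = real n * p n" using True by (subst prob_edge) auto
    also have "\<dots> \<le> ?b n" using True assms by (intro first_moment_le) auto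
    finally show ?thesis by (simp add: emeasure_eq_measure ennreal_leI)
  next
    case False
    then show ?thesis by (simp add: S_def)
  qed
  moreover have "{\<omega> \<in> space M. long_crossed L i \<omega>} = (\<Union>n. S n)"
    by (auto simp: S_def long_crossed_def)
  moreover have "emeasure M (\<Union>n. S n) \<le> (\<Sum>n. emeasure M (S n))"
    by (rule emeasure_subadditive_countably) auto
  ultimately have "emeasure M {\<omega> \<in> space M. long_crossed L i \<omega>} \<le> (\<Sum>n. ennreal (?b n))"
    by (simp add: order_trans[OF _ suminf_le])
  also have "\<dots> = ennreal (crossing_mass * real L powr - decay)"
    using summable_powr_half_s b_nonneg
    by (subst suminf_ennreal2) (auto simp: suminf_mult crossing_mass_def mult_ac intro!: summable_mult)
  finally show ?thesis
    using crossing_mass_nonneg by (simp add: emeasure_eq_measure)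
qed

text \<open>The \<open>n\<close> possible edges of length \<open>n\<close> across \<open>(i, i+1)\<close> contribute the factor \<open>(1 - p n)\<^sup>n\<close>.
  The infinite product does not vanish because \<open>\<Sum>n. n p(n)\<close> converges for \<open>s > 2\<close>.\<close>

lemma no_crossing_prob_bounded_below:
  obtains \<theta> :: real where "\<theta> > 0" "\<And>L. \<theta> \<le> (\<Prod>n\<in>{2..L}. (1 - p n) ^ n)"
proof -
  \<comment> \<open>Beyond \<open>N\<close> the Weierstrass product inequality leaves at least \<open>1 - 1/2\<close>; the finitely many
    earlier factors are positive because \<open>p n < 1\<close> for \<open>n \<ge> 2\<close>.\<close>
  obtain N where N: "\<And>m n. m \<ge> N \<Longrightarrow> norm (sum (\<lambda>n. real n * p n) {m..<n}) < 1 / 2"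
    using summable_first_moment[unfolded summable_Cauchy] by (metis half_gt_zero_iff zero_less_one)
  define c where "c = (\<Prod>n\<in>{2..N+1}. (1 - p n) ^ n)"
  have c: "c > 0" unfolding c_def using p_range by (intro prod_pos) auto
  have "c * (1 / 2) \<le> (\<Prod>n\<in>{2..L}. (1 - p n) ^ n)" for L
  proof -
    define L' where "L' = max L (N + 1)"
    let ?T = "{N+2..<Suc L'}"
    have "1 - (\<Sum>(n, j)\<in>(SIGMA n:?T. {..<n}). p n)
        \<le> (\<Prod>z\<in>(SIGMA n:?T. {..<n}). 1 - (case z of (n, j) \<Rightarrow> p n))"
      using p_01 by (intro Weierstrass_prod_ineq) auto
    also have "\<dots> = (\<Prod>n\<in>?T. \<Prod>j\<in>{..<n}. 1 - p n)"
      by (subst prod.Sigma) (auto simp: case_prod_beta)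
    finally have "1 - (\<Sum>n\<in>?T. \<Sum>j\<in>{..<n}. p n) \<le> (\<Prod>n\<in>?T. (1 - p n) ^ n)"
      by (subst sum.Sigma) (auto simp: case_prod_beta)
    moreover have "(\<Sum>n\<in>?T. real n * p n) < 1 / 2"
      using N[of "N + 2" "Suc L'"] by simp
    ultimately have half: "1 / 2 \<le> (\<Prod>n\<in>?T. (1 - p n) ^ n)" by simp
    have "c * (1 / 2) \<le> c * (\<Prod>n\<in>?T. (1 - p n) ^ n)"
      using c half by (intro mult_left_mono) auto
    also have "\<dots> = (\<Prod>n\<in>{2..N+1} \<union> ?T. (1 - p n) ^ n)"
      unfolding c_def by (intro prod.union_disjoint[symmetric]) auto
    also have "{2..N+1} \<union> ?T = {2..L} \<union> ({2..L'} - {2..L})"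
      by (auto simp: L'_def)
    also have "(\<Prod>n\<in>\<dots>. (1 - p n) ^ n)
        = (\<Prod>n\<in>{2..L}. (1 - p n) ^ n) * (\<Prod>n\<in>{2..L'} - {2..L}. (1 - p n) ^ n)"
      by (intro prod.union_disjoint) auto
    also have "\<dots> \<le> (\<Prod>n\<in>{2..L}. (1 - p n) ^ n) * 1"
      using p_01 by (intro mult_left_mono prod_le_1 prod_nonneg) (auto intro!: power_le_one zero_le_power)
    finally show ?thesis by simp
  qed
  with c show ?thesis by (intro that[of "c * (1 / 2)"]) auto
qed

text \<open>Almost surely, \<open>(i, i+1)\<close> can only fail to be a cut edge because of a crossing edge of length
  between 2 and \<open>L\<close> or because of a longer one. The first kind of failure is independent at distance \<open>L\<close>, so
  Chebyshev's inequality applies; the second kind is rare and is controlled by its expectation.\<close>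

lemma prob_few_cut_edges:
  fixes N L :: nat and c :: int and \<theta> :: real
  assumes \<theta>: "\<theta> > 0" "\<And>L. \<theta> \<le> (\<Prod>n\<in>{2..L}. (1 - p n) ^ n)" and "N \<ge> 1" "L \<ge> 1"
  shows "prob {\<omega> \<in> space M. real (card {i \<in> {c..<c + int N}. cut_edge \<omega> i}) < \<theta> * N / 2}
     \<le> 32 / \<theta>\<^sup>2 * (L / N) + 4 * crossing_mass / \<theta> * real L powr - decay"
proof -
  let ?I = "{c..<c + int N}"
  define a where "a = (\<Prod>n\<in>{2..L}. (1 - p n) ^ n)"
  define A where "A i = {\<omega> \<in> space M. \<forall>e\<in>short_crossing_edges i L. \<not> \<omega> e}" for i
  define B where "B i = {\<omega> \<in> space M. long_crossed L i \<omega>}" for i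
  \<comment> \<open>The expected number of points without short crossing edges is at least \<open>\<theta> N = 4 t\<close>; a loss
    of \<open>t\<close> is allowed for its fluctuation and another one for the points crossed by long edges.\<close>
  define t where "t = \<theta> * N / 4"
  have t: "t > 0" using assms by (simp add: t_def)
  have A [measurable]: "A i \<in> sets M" for i
    unfolding A_def
    using edge_measurable[unfolded pred_def, OF short_crossing_edges_pairs[THEN subsetD]]
    by (intro sets.sets_Collect_finite_All sets.sets_Collect_neg finite_short_crossing_edges) auto
  have B [measurable]: "B i \<in> sets M" for i unfolding B_def by measurable
  define X where "X \<omega> = (\<Sum>i\<in>?I. indicator (A i) \<omega> :: real)" for \<omega>
  define W where "W \<omega> = (\<Sum>i\<in>?I. indicator (B i) \<omega> :: real)" for \<omega>
  have [measurable]: "X \<in> borel_measurable M" "W \<in> borel_measurable M"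
    unfolding X_def W_def by measurable
  have PX: "prob {\<omega> \<in> space M. X \<omega> \<le> a * N - t} \<le> 2 * L * N / t\<^sup>2"
    using prob_few_finitely_dependent_events[of ?I A a L t] t
    by (simp add: X_def A_def[abs_def] prob_no_short_crossing prob_no_short_crossing_indep a_def
        A[unfolded A_def])
  have PW: "prob {\<omega> \<in> space M. t \<le> W \<omega>} \<le> N * (crossing_mass * real L powr - decay) / t"
  proof -
    have W0: "0 \<le> W \<omega>" for \<omega> by (simp add: W_def sum_nonneg)
    have "(\<integral>\<^sup>+\<omega>. ennreal (W \<omega>) \<partial>M) = (\<integral>\<^sup>+\<omega>. (\<Sum>i\<in>?I. indicator (B i) \<omega>) \<partial>M)"
      unfolding W_def by (subst sum_ennreal[symmetric]) (auto simp: ennreal_indicator)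
    also have "\<dots> = (\<Sum>i\<in>?I. ennreal (prob (B i)))"
      by (subst nn_integral_sum) (auto simp: emeasure_eq_measure)
    also have "\<dots> \<le> (\<Sum>i\<in>?I. ennreal (crossing_mass * real L powr - decay))"
      unfolding B_def using assms by (intro sum_mono ennreal_leI prob_long_crossed) auto
    also have "\<dots> = ennreal (N * (crossing_mass * real L powr - decay))"
      using crossing_mass_nonneg by (simp add: ennreal_mult ennreal_of_nat_eq_real_of_nat)
    finally have "prob {\<omega> \<in> space M. ennreal t \<le> ennreal (W \<omega>)}
        \<le> N * (crossing_mass * real L powr - decay) / t"
      using t crossing_mass_nonneg by (intro prob_ge_le_of_nn_integral) auto
    then show ?thesis using W0 by simp
  qed
  have count: "X \<omega> - W \<omega> \<le> card {i \<in> ?I. cut_edge \<omega> i}"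
    if nn: "\<forall>i. \<omega> {i, i + 1}" and \<omega>: "\<omega> \<in> space M" for \<omega>
  proof -
    have "indicator (A i) \<omega> - indicator (B i) \<omega> \<le> (of_bool (cut_edge \<omega> i) :: real)" for i
      using cut_edgeI[of \<omega> i L] nn \<omega> by (auto simp: A_def B_def indicator_def)
    then have "X \<omega> - W \<omega> \<le> (\<Sum>i\<in>?I. of_bool (cut_edge \<omega> i))"
      unfolding X_def W_def sum_subtractf[symmetric] by (intro sum_mono)
    also have "\<dots> = card {i \<in> ?I. cut_edge \<omega> i}"
      by (subst sum_of_bool_eq) (auto simp: Int_def)
    finally show ?thesis .
  qed
  have "prob {\<omega> \<in> space M. real (card {i \<in> ?I. cut_edge \<omega> i}) < \<theta> * N / 2}
      \<le> prob ({\<omega> \<in> space M. X \<omega> \<le> a * N - t} \<union> {\<omega> \<in> space M. t \<le> W \<omega>})"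
  proof (rule finite_measure_mono_AE)
    show "AE \<omega> in M. \<omega> \<in> {\<omega> \<in> space M. real (card {i \<in> ?I. cut_edge \<omega> i}) < \<theta> * N / 2}
        \<longrightarrow> \<omega> \<in> {\<omega> \<in> space M. X \<omega> \<le> a * N - t} \<union> {\<omega> \<in> space M. t \<le> W \<omega>}"
      using AE_nearest_neighbour
    proof eventually_elim
      case (elim \<omega>)
      have "\<theta> * N \<le> a * N" using \<theta>(2)[of L] by (simp add: a_def mult_right_mono)
      moreover have "\<theta> * N / 2 = \<theta> * N - t - t" by (simp add: t_def)
      ultimately show ?case using count[OF elim] by auto
    qed
  qed measurable
  also have "\<dots> \<le> prob {\<omega> \<in> space M. X \<omega> \<le> a * N - t} + prob {\<omega> \<in> space M. t \<le> W \<omega>}"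
    by (rule measure_Un_le) measurable
  also have "\<dots> \<le> 2 * L * N / t\<^sup>2 + N * (crossing_mass * real L powr - decay) / t"
    by (intro add_mono PX PW)
  also have "\<dots> = 32 / \<theta>\<^sup>2 * (L / N) + 4 * crossing_mass / \<theta> * real L powr - decay"
    using assms by (simp add: t_def power2_eq_square field_simps)
  finally show ?thesis .
qed

end


context long_range_profile
begin

section \<open>Resistance estimates in probability\<close>

text \<open>The cut-off length \<open>L \<approx> \<surd>N\<close> makes both error terms a negative power of \<open>N\<close>.\<close>

lemma prob_few_cut_edges_power:
  obtains \<theta> q C :: real where "\<theta> > 0" "0 < q" "q \<le> 1 / 2" "C \<ge> 0"
    "\<And>(N::nat) c. N \<ge> 1 \<Longrightarrow>
       prob {\<omega> \<in> space M. real (card {i \<in> {c..<c + int N}. cut_edge \<omega> i}) < \<theta> * N / 2}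
         \<le> C * real N powr - q"
proof -
  obtain \<theta> :: real where \<theta>: "\<theta> > 0" "\<And>L. \<theta> \<le> (\<Prod>n\<in>{2..L}. (1 - p n) ^ n)"
    by (rule no_crossing_prob_bounded_below) blast
  define q where "q = min (1 / 2) (decay / 2)"
  define C where "C = 64 / \<theta>\<^sup>2 + 4 * crossing_mass / \<theta>"
  have bound: "prob {\<omega> \<in> space M. real (card {i \<in> {c..<c + int N}. cut_edge \<omega> i}) < \<theta> * N / 2}
         \<le> C * real N powr - q" if N: "N \<ge> 1" for N :: nat and c
  proof -
    define L where "L = nat \<lceil>sqrt N\<rceil>"
    have sqrt1: "sqrt N \<ge> 1" using N by simp
    have L: "sqrt N \<le> L" "L \<le> 2 * sqrt N" "L \<ge> 1"
      using sqrt1 unfolding L_def by linarith+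
    have sqrt_powr: "sqrt N = real N powr (1 / 2)" by (simp add: powr_half_sqrt)
    have "L / N \<le> 2 * sqrt N / N" using L by (intro divide_right_mono) auto
    also have "\<dots> = 2 * real N powr - (1 / 2)"
      using N by (simp add: powr_minus powr_half_sqrt real_div_sqrt field_simps)
    also have "\<dots> \<le> 2 * real N powr - q"
      using N by (intro mult_left_mono powr_mono) (auto simp: q_def)
    finally have 1: "L / N \<le> 2 * real N powr - q" .
    have "real L powr - decay \<le> sqrt N powr - decay"
      using L sqrt1 decay_pos by (intro powr_mono2') auto
    also have "\<dots> = real N powr - (decay / 2)"
      unfolding sqrt_powr powr_powr by simp
    also have "\<dots> \<le> real N powr - q"
      using N by (intro powr_mono) (auto simp: q_def)
    finally have 2: "real L powr - decay \<le> real N powr - q" .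
    have "prob {\<omega> \<in> space M. real (card {i \<in> {c..<c + int N}. cut_edge \<omega> i}) < \<theta> * N / 2}
        \<le> 32 / \<theta>\<^sup>2 * (L / N) + 4 * crossing_mass / \<theta> * real L powr - decay"
      by (rule prob_few_cut_edges[OF \<theta> N L(3)])
    also have "\<dots> \<le> 32 / \<theta>\<^sup>2 * (2 * real N powr - q) + 4 * crossing_mass / \<theta> * real N powr - q"
      using 1 2 \<theta>(1) crossing_mass_nonneg by (intro add_mono mult_left_mono) auto
    also have "\<dots> = C * real N powr - q" by (simp add: C_def field_simps)
    finally show ?thesis .
  qed
  show ?thesis
    by (rule that[OF \<theta>(1) _ _ _ bound])
      (use \<theta>(1) decay_pos crossing_mass_nonneg in \<open>auto simp: q_def C_def\<close>)
qed

text \<open>Every window of the size of the ball contains many cut edges with high probability; the two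
  windows used here lie on either side of 0.\<close>

lemma prob_R_eff_small_large_radius:
  obtains \<theta> q C :: real where "\<theta> > 0" "0 < q" "q \<le> 1 / 2" "C \<ge> 0"
    "\<And>R. R \<ge> 1 \<Longrightarrow>
       prob {\<omega> \<in> space M. R_eff_sets \<omega> {0} (- open_ball (ennreal R)) < ennreal (\<theta> * R)}
         \<le> C * R powr - q"
proof -
  obtain \<theta> q C :: real where *: "\<theta> > 0" "0 < q" "q \<le> 1 / 2" "C \<ge> 0"
    and few: "\<And>(N::nat) c. N \<ge> 1 \<Longrightarrow>
       prob {\<omega> \<in> space M. real (card {i \<in> {c..<c + int N}. cut_edge \<omega> i}) < \<theta> * N / 2}
         \<le> C * real N powr - q"
    by (rule prob_few_cut_edges_power) blast
  have bound: "prob {\<omega> \<in> space M. R_eff_sets \<omega> {0} (- open_ball (ennreal R)) < ennreal (\<theta> / 4 * R)}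
         \<le> 2 * C * R powr - q" if R: "R \<ge> 1" for R
  proof -
    define N where "N = nat \<lceil>R\<rceil>"
    have N: "N \<ge> 1" "R \<le> N" "\<lceil>R\<rceil> = int N" using R unfolding N_def by linarith+
    define Few where "Few c = {\<omega> \<in> space M. real (card {i \<in> {c..<c + int N}. cut_edge \<omega> i}) < \<theta> * N / 2}" for c
    have Few [measurable]: "Few c \<in> sets M" for c
    proof -
      have "real (card {i \<in> {c..<c + int N}. cut_edge \<omega> i})
          = (\<Sum>i\<in>{c..<c + int N}. if cut_edge \<omega> i then 1 else 0)" for \<omega>
        by (subst sum.If_cases) (auto simp: Int_def)
      then show ?thesis unfolding Few_def by simp
    qed
    have "R_eff_sets \<omega> {0} (- open_ball (ennreal R)) \<ge> ennreal (\<theta> / 4 * R)"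
      if \<omega>: "\<omega> \<in> space M" "\<omega> \<notin> Few 0" "\<omega> \<notin> Few (- int N)" for \<omega>
    proof -
      have "ennreal (\<theta> / 4 * R) \<le> ennreal (\<theta> * N / 2 / 2)"
        using N * by (intro ennreal_leI) simp
      also have "\<dots> \<le> R_eff_sets \<omega> {0} (- open_ball (ennreal R))"
      proof (rule R_eff_sets_ge_cut_edges)
        show "- open_ball (ennreal R) \<subseteq> {y. int N \<le> \<bar>y\<bar>}"
          using N by (auto simp: open_ball_real)
      qed (use * N \<omega> in \<open>auto simp: Few_def\<close>)
      finally show ?thesis .
    qed
    then have "{\<omega> \<in> space M. R_eff_sets \<omega> {0} (- open_ball (ennreal R)) < ennreal (\<theta> / 4 * R)}
        \<subseteq> Few 0 \<union> Few (- int N)"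
      by (auto simp: not_less[symmetric])
    then have "prob {\<omega> \<in> space M. R_eff_sets \<omega> {0} (- open_ball (ennreal R)) < ennreal (\<theta> / 4 * R)}
        \<le> prob (Few 0 \<union> Few (- int N))"
      by (intro finite_measure_mono) auto
    also have "\<dots> \<le> prob (Few 0) + prob (Few (- int N))"
      by (rule measure_Un_le) auto
    also have "\<dots> \<le> C * real N powr - q + C * real N powr - q"
      unfolding Few_def by (intro add_mono few N)
    also have "\<dots> \<le> C * R powr - q + C * R powr - q"
      using * N R by (intro add_mono mult_left_mono powr_mono2') auto
    finally show ?thesis by simp
  qed
  show ?thesis
    by (rule that[OF _ *(2,3) _ bound]) (use * in auto)
qed

lemma prob_R_eff_small_small_radius:
  assumes "R \<ge> 1" "lam > 0"
  shows "prob {\<omega> \<in> space M. R_eff_sets \<omega> {0} (- open_ball (ennreal R)) < ennreal (R / lam)}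
     \<le> mean_degree * R / lam"
proof -
  have "prob {\<omega> \<in> space M. R_eff_sets \<omega> {0} (- open_ball (ennreal R)) < ennreal (R / lam)}
      \<le> prob {\<omega> \<in> space M. ennreal (lam / R) \<le> num_edges \<omega> 0}"
  proof (intro finite_measure_mono subsetI CollectI conjI; clarify?)
    fix \<omega> assume small: "R_eff_sets \<omega> {0} (- open_ball (ennreal R)) < ennreal (R / lam)"
    show "ennreal (lam / R) \<le> num_edges \<omega> 0"
    proof (rule ccontr)
      assume "\<not> ?thesis"
      then have "inverse (ennreal (lam / R)) \<le> inverse (num_edges \<omega> 0)"
        by (intro ennreal_inverse_antimono) auto
      also have "\<dots> \<le> R_eff_sets \<omega> {0} (- open_ball (ennreal R))"
        using assms by (intro R_eff_sets_ge_degree) (auto simp: open_ball_real)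
      finally show False using small assms by (simp add: inverse_ennreal)
    qed
  qed measurable
  also have "\<dots> \<le> mean_degree / (lam / R)"
    using assms mean_degree_nonneg by (intro prob_ge_le_of_nn_integral) (auto simp: nn_integral_num_edges)
  finally show ?thesis by simp
qed

text \<open>The bound through the degree of 0 increases in \<open>R\<close> and the one through cut edges decreases.
  Separating the radii at \<open>\<surd>\<lambda>\<close> turns both into a negative power of \<open>\<lambda>\<close> that does not depend
  on \<open>R\<close>.\<close>

lemma prob_R_eff_small:
  obtains lam0 q C :: real where "lam0 > 1" "0 < q" "q \<le> 1" "C \<ge> 0"
    "\<And>R lam. R \<ge> 1 \<Longrightarrow> lam \<ge> lam0 \<Longrightarrow>
       prob {\<omega> \<in> space M. R_eff_sets \<omega> {0} (- open_ball (ennreal R)) < ennreal (R / lam)}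
         \<le> C * lam powr - q"
proof -
  obtain \<theta> q C :: real where *: "\<theta> > 0" "0 < q" "q \<le> 1 / 2" "C \<ge> 0"
    and large: "\<And>R. R \<ge> 1 \<Longrightarrow>
       prob {\<omega> \<in> space M. R_eff_sets \<omega> {0} (- open_ball (ennreal R)) < ennreal (\<theta> * R)}
         \<le> C * R powr - q"
    by (rule prob_R_eff_small_large_radius) blast
  \<comment> \<open>\<open>\<lambda> \<ge> 1/\<theta>\<close> ensures \<open>R/\<lambda> \<le> \<theta> R\<close>.\<close>
  define lam0 where "lam0 = max 2 (1 / \<theta>)"
  have bound: "prob {\<omega> \<in> space M. R_eff_sets \<omega> {0} (- open_ball (ennreal R)) < ennreal (R / lam)}
         \<le> (mean_degree + C) * lam powr - (q / 2)" if R: "R \<ge> 1" and lam: "lam \<ge> lam0" for R lam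
  proof -
    have lam1: "lam \<ge> 2" "1 / \<theta> \<le> lam" using lam by (auto simp: lam0_def)
    let ?P = "\<lambda>r. prob {\<omega> \<in> space M. R_eff_sets \<omega> {0} (- open_ball (ennreal R)) < ennreal r}"
    have sqrt_powr: "sqrt lam = lam powr (1 / 2)" using lam1 by (simp add: powr_half_sqrt)
    show ?thesis
    proof (cases "R \<le> sqrt lam")
      case True
      have "?P (R / lam) \<le> mean_degree * R / lam"
        using R lam1 by (intro prob_R_eff_small_small_radius) auto
      also have "\<dots> \<le> mean_degree * sqrt lam / lam"
        using True mean_degree_nonneg lam1 by (intro divide_right_mono mult_left_mono) auto
      also have "\<dots> = mean_degree * lam powr - (1 / 2)"
        using lam1 by (simp add: powr_minus powr_half_sqrt real_div_sqrt field_simps)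
      also have "\<dots> \<le> (mean_degree + C) * lam powr - (q / 2)"
        using lam1 * mean_degree_nonneg by (intro mult_mono powr_mono) auto
      finally show ?thesis .
    next
      case False
      have "R / lam \<le> \<theta> * R"
        using lam1 R * by (simp add: field_simps mult_le_cancel_left1)
      then have "?P (R / lam) \<le> ?P (\<theta> * R)"
        by (intro finite_measure_mono) (auto intro: less_le_trans ennreal_leI)
      also have "\<dots> \<le> C * R powr - q" by (rule large[OF R])
      also have "\<dots> \<le> C * sqrt lam powr - q"
        using False lam1 * by (intro mult_left_mono powr_mono2') auto
      also have "\<dots> = C * lam powr - (q / 2)"
        unfolding sqrt_powr powr_powr by simp
      also have "\<dots> \<le> (mean_degree + C) * lam powr - (q / 2)"
        using mean_degree_nonneg by (intro mult_right_mono) auto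
      finally show ?thesis .
    qed
  qed
  show ?thesis
    by (rule that[of lam0 "q / 2" "mean_degree + C"])
      (use * mean_degree_nonneg bound in \<open>auto simp: lam0_def simp del: max.bounded_iff\<close>)
qed

section \<open>Good radii and the mean of resistance times volume\<close>

lemma AE_R_eff_le: "AE \<omega> in M. \<forall>y. R_eff \<omega> 0 y \<le> ennreal \<bar>real_of_int y\<bar>"
  using AE_nearest_neighbour
proof eventually_elim
  case (elim \<omega>)
  then have nn: "\<omega> {i, i + 1}" for i by blast
  have "R_eff \<omega> 0 y \<le> ennreal \<bar>real_of_int y\<bar>" if "y \<noteq> 0" for y
    using R_eff_sets_le_dist[of \<omega> 0 "{0}" y "{y}"] nn that by (simp add: R_eff_def)
  then show ?case by (auto simp: R_eff_def)
qed

lemma AE_ball_vol_ge: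
  assumes "R \<ge> 1"
  shows "AE \<omega> in M. ennreal R \<le> ball_vol \<omega> (ennreal R)"
  using AE_nearest_neighbour
proof eventually_elim
  case (elim \<omega>)
  have "1 \<le> num_edges \<omega> x" for x
  proof -
    have "emeasure (count_space UNIV) {{x, x + 1}} \<le> num_edges \<omega> x"
      unfolding num_edges_def using elim by (intro emeasure_mono) auto
    then show ?thesis by simp
  qed
  then have "(\<Sum>x\<in>{- \<lceil>R\<rceil><..<\<lceil>R\<rceil>}. 1) \<le> ball_vol \<omega> (ennreal R)"
    unfolding ball_vol_real by (intro sum_mono)
  moreover have "ennreal R \<le> (\<Sum>x\<in>{- \<lceil>R\<rceil><..<\<lceil>R\<rceil>}. 1)"
  proof -
    have "R \<le> real (nat (2 * \<lceil>R\<rceil> - 1))" using assms by linarith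
    then show ?thesis by (simp add: ennreal_of_nat_eq_real_of_nat algebra_simps ennreal_leI)
  qed
  ultimately show ?case by (rule order_trans[rotated])
qed

lemma prob_J:
  obtains lam0 q C :: real where "lam0 > 1" "0 < q" "C > 0"
    "\<And>R lam. R \<ge> 1 \<Longrightarrow> lam \<ge> lam0 \<Longrightarrow>
       prob {\<omega> \<in> space M. ennreal R \<in> J \<omega> lam} \<ge> 1 - C * lam powr - q"
proof -
  obtain lam0 q C :: real where *: "lam0 > 1" "0 < q" "q \<le> 1" "C \<ge> 0"
    and small: "\<And>R lam. R \<ge> 1 \<Longrightarrow> lam \<ge> lam0 \<Longrightarrow>
       prob {\<omega> \<in> space M. R_eff_sets \<omega> {0} (- open_ball (ennreal R)) < ennreal (R / lam)}
         \<le> C * lam powr - q"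
    by (rule prob_R_eff_small) blast
  have bound: "prob {\<omega> \<in> space M. ennreal R \<in> J \<omega> lam} \<ge> 1 - (C + 4 * mean_degree + 1) * lam powr - q"
    if R: "R \<ge> 1" and lam: "lam \<ge> lam0" for R lam
  proof -
    have lam1: "lam > 1" using lam * by simp
    define G where "G = {\<omega> \<in> space M. ennreal R \<in> J \<omega> lam}"
    define S where "S = {\<omega> \<in> space M. R_eff_sets \<omega> {0} (- open_ball (ennreal R)) < ennreal (R / lam)}"
    define V where "V = {\<omega> \<in> space M. ennreal (lam * R) \<le> ball_vol \<omega> (ennreal R)}"
    have meas [measurable]: "G \<in> sets M" "S \<in> sets M" "V \<in> sets M"
      unfolding G_def S_def V_def by (rule J_measurable, measurable)
    have pV: "prob V \<le> 4 * mean_degree / lam"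
    proof -
      have "prob V \<le> 4 * mean_degree * R / (lam * R)"
        unfolding V_def using R lam1 mean_degree_nonneg
        by (intro prob_ge_le_of_nn_integral nn_integral_ball_vol) auto
      then show ?thesis using R by simp
    qed
    have inv: "ennreal (inverse lam) * ennreal R = ennreal (R / lam)"
      using lam1 R by (simp add: ennreal_mult[symmetric] divide_inverse mult.commute)
    have "1 - prob G = prob (space M - G)"
      by (simp add: prob_compl)
    also have "\<dots> \<le> prob (S \<union> V)"
    proof (rule finite_measure_mono_AE)
      show "AE \<omega> in M. \<omega> \<in> space M - G \<longrightarrow> \<omega> \<in> S \<union> V"
        using AE_R_eff_le AE_ball_vol_ge[OF R] AE_space
      proof eventually_elim
        case (elim \<omega>)
        have "ennreal R \<in> J \<omega> lam" if "\<omega> \<notin> S \<union> V"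
          unfolding J_def mem_Collect_eq inv
        proof (intro conjI ballI)
          show "1 \<le> ennreal R" using R by (metis ennreal_1 ennreal_leI)
          show "ennreal (R / lam) \<le> ball_vol \<omega> (ennreal R)"
            using elim(2) lam1 R
            by (intro order_trans[OF ennreal_leI elim(2)]) (simp add: field_simps mult_le_cancel_left1)
          show "ball_vol \<omega> (ennreal R) \<le> ennreal lam * ennreal R"
            using that elim R lam1 by (auto simp: V_def not_le ennreal_mult[symmetric])
          show "ennreal (R / lam) \<le> R_eff_sets \<omega> {0} (- open_ball (ennreal R))"
            using that elim by (auto simp: S_def not_less)
          fix y
          have "ennreal \<bar>real_of_int y\<bar> \<le> ennreal (lam * real_of_int \<bar>y\<bar>)"
            using lam1 by (intro ennreal_leI) (simp add: mult_le_cancel_right1)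
          then show "R_eff \<omega> 0 y \<le> ennreal (lam * real_of_int \<bar>y\<bar>)"
            using elim(1) order_trans by blast
        qed
        then show ?case by (auto simp: G_def)
      qed
    qed measurable
    also have "\<dots> \<le> prob S + prob V" by (rule measure_Un_le) measurable
    also have "\<dots> \<le> C * lam powr - q + 4 * mean_degree / lam"
      using pV small[OF R lam] unfolding S_def by (intro add_mono) auto
    also have "4 * mean_degree / lam = 4 * mean_degree * lam powr - 1"
      using lam1 by (simp add: powr_minus_divide)
    also have "\<dots> \<le> 4 * mean_degree * lam powr - q"
      using lam1 * mean_degree_nonneg by (intro mult_left_mono powr_mono) auto
    also have "C * lam powr - q + 4 * mean_degree * lam powr - q
        \<le> (C + 4 * mean_degree + 1) * lam powr - q" by (simp add: algebra_simps)
    finally show ?thesis by (simp add: G_def)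
  qed
  show ?thesis
    by (rule that[OF *(1,2) _ bound]) (use * mean_degree_nonneg in auto)
qed

lemma nn_integral_R_eff_times_vol:
  assumes R: "R \<ge> 1"
  shows "(\<integral>\<^sup>+\<omega>. R_eff_sets \<omega> {0} (- open_ball (ennreal R)) * ball_vol \<omega> (ennreal R) \<partial>M)
     \<le> ennreal (8 * mean_degree * R\<^sup>2)"
proof -
  have ceil: "\<lceil>R\<rceil> \<noteq> 0" using R by linarith
  have "AE \<omega> in M. R_eff_sets \<omega> {0} (- open_ball (ennreal R)) \<le> ennreal (2 * R)"
    using AE_nearest_neighbour
  proof eventually_elim
    case (elim \<omega>)
    have "R_eff_sets \<omega> {0} (- open_ball (ennreal R)) \<le> ennreal (real_of_int \<bar>0 - \<lceil>R\<rceil>\<bar>)"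
      using elim ceil by (intro R_eff_sets_le_dist) (auto simp: open_ball_real)
    also have "\<dots> \<le> ennreal (2 * R)"
      using R by (intro ennreal_leI) linarith
    finally show ?case .
  qed
  then have "(\<integral>\<^sup>+\<omega>. R_eff_sets \<omega> {0} (- open_ball (ennreal R)) * ball_vol \<omega> (ennreal R) \<partial>M)
      \<le> (\<integral>\<^sup>+\<omega>. ennreal (2 * R) * ball_vol \<omega> (ennreal R) \<partial>M)"
    by (intro nn_integral_mono_AE) (auto elim!: eventually_mono intro!: mult_right_mono)
  also have "\<dots> = ennreal (2 * R) * (\<integral>\<^sup>+\<omega>. ball_vol \<omega> (ennreal R) \<partial>M)"
    by (rule nn_integral_cmult) measurable
  also have "\<dots> \<le> ennreal (2 * R) * ennreal (4 * mean_degree * R)"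
    using R by (intro mult_left_mono nn_integral_ball_vol) auto
  also have "\<dots> = ennreal (8 * mean_degree * R\<^sup>2)"
    using R mean_degree_nonneg by (simp add: ennreal_mult[symmetric] power2_eq_square mult_ac)
  finally show ?thesis .
qed

end

lemma asymptotic_power_upper_bound:
  fixes p :: "nat \<Rightarrow> real"
  assumes "\<beta> > 0" and lim: "(\<lambda>n. p n / (\<beta> * real n powr (- s))) \<longlonglongrightarrow> 1"
  obtains K where "\<And>n. n \<ge> 1 \<Longrightarrow> p n \<le> K * real n powr - s"
proof -
  from lim have "Bseq (\<lambda>n. p n / (\<beta> * real n powr (- s)))"
    by (intro convergent_imp_Bseq convergentI)
  then obtain c where c: "\<And>n. norm (p n / (\<beta> * real n powr (- s))) \<le> c"
    by (auto simp: Bseq_def)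
  show ?thesis
  proof (rule that[of "c * \<beta>"])
    fix n :: nat assume "n \<ge> 1"
    then have pos: "\<beta> * real n powr (- s) > 0" using \<open>\<beta> > 0\<close> by simp
    have "p n / (\<beta> * real n powr (- s)) \<le> c"
      using c[of n] unfolding real_norm_def by linarith
    then have "p n \<le> c * (\<beta> * real n powr (- s))" using pos by (simp add: pos_divide_le_eq)
    then show "p n \<le> c * \<beta> * real n powr - s" by (simp add: mult_ac)
  qed
qed

theorem theorem2p2:
  fixes s \<beta> :: real and p :: "nat \<Rightarrow> real"
  assumes "s > 2" and "\<beta> > 0"
    and "p 1 = 1"
    and "\<And>n. n \<ge> 2 \<Longrightarrow> 0 \<le> p n \<and> p n < 1"
    and "(\<lambda>n. p n / (\<beta> * real n powr (- s))) \<longlonglongrightarrow> 1"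
  shows "(\<exists>(lam0::real) (pstar :: real \<Rightarrow> real).
            lam0 > 1 \<and> (pstar \<longlongrightarrow> 0) at_top \<and>
            (\<forall>(R::real) lam::real. R \<ge> 1 \<longrightarrow> lam \<ge> lam0 \<longrightarrow>
               \<P>(\<omega> in long_range_percolation p. ennreal R \<in> J \<omega> lam) \<ge> 1 - pstar lam) \<and>
            (\<exists>(q0::real) (c2::real). q0 > 0 \<and> c2 > 0 \<and>
               (\<forall>lam>1. pstar lam \<le> c2 * lam powr (- q0)))) \<and>
         (\<exists>c1::real. c1 > 0 \<and>
            (\<forall>R::real. R \<ge> 1 \<longrightarrow>
               (\<integral>\<^sup>+\<omega>. R_eff_sets \<omega> {0} (- open_ball (ennreal R)) * ball_vol \<omega> (ennreal R)
                  \<partial>long_range_percolation p) \<le> ennreal (c1 * R\<^sup>2)))"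
proof -
  obtain K where "\<And>n. n \<ge> 1 \<Longrightarrow> p n \<le> K * real n powr - s"
    using asymptotic_power_upper_bound[OF assms(2,5)] by blast
  then interpret long_range_profile p s K
    using assms by unfold_locales auto
  obtain lam0 q C :: real where *: "lam0 > 1" "0 < q" "C > 0"
    "\<And>R lam. R \<ge> 1 \<Longrightarrow> lam \<ge> lam0 \<Longrightarrow>
       prob {\<omega> \<in> space M. ennreal R \<in> J \<omega> lam} \<ge> 1 - C * lam powr - q"
    by (rule prob_J) blast
  have lim: "((\<lambda>lam. C * lam powr - q) \<longlongrightarrow> 0) at_top"
    using tendsto_mult_right_zero[OF tendsto_neg_powr[of "- q", OF _ filterlim_ident]] \<open>0 < q\<close> by simp
  have 1: "\<exists>(lam0::real) (pstar :: real \<Rightarrow> real).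
            lam0 > 1 \<and> (pstar \<longlongrightarrow> 0) at_top \<and>
            (\<forall>(R::real) lam::real. R \<ge> 1 \<longrightarrow> lam \<ge> lam0 \<longrightarrow>
               \<P>(\<omega> in long_range_percolation p. ennreal R \<in> J \<omega> lam) \<ge> 1 - pstar lam) \<and>
            (\<exists>(q0::real) (c2::real). q0 > 0 \<and> c2 > 0 \<and>
               (\<forall>lam>1. pstar lam \<le> c2 * lam powr (- q0)))"
  proof (rule exI[of _ lam0], rule exI[of _ "\<lambda>lam. C * lam powr - q"], intro conjI)
    show "\<exists>q0 c2. q0 > 0 \<and> c2 > 0 \<and> (\<forall>lam>1. C * lam powr - q \<le> c2 * lam powr - q0)"
      by (rule exI[of _ q], rule exI[of _ C]) (use * in auto)
  qed (use * lim in auto)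
  have "(\<integral>\<^sup>+\<omega>. R_eff_sets \<omega> {0} (- open_ball (ennreal R)) * ball_vol \<omega> (ennreal R) \<partial>M)
      \<le> ennreal ((8 * mean_degree + 1) * R\<^sup>2)" if "R \<ge> 1" for R
    by (rule order_trans[OF nn_integral_R_eff_times_vol[OF that]])
      (auto intro!: ennreal_leI mult_right_mono)
  then have 2: "\<exists>c1::real. c1 > 0 \<and>
            (\<forall>R::real. R \<ge> 1 \<longrightarrow>
               (\<integral>\<^sup>+\<omega>. R_eff_sets \<omega> {0} (- open_ball (ennreal R)) * ball_vol \<omega> (ennreal R)
                  \<partial>long_range_percolation p) \<le> ennreal (c1 * R\<^sup>2))"
    using mean_degree_nonneg by (intro exI[of _ "8 * mean_degree + 1"]) auto
  from 1 2 show ?thesis by (rule conjI)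
qed

end
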